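(* Let $s\ge 1$ be an integer. On $s$-bounded instances of buffer management with bounded delay, and likewise on instances with at most $s$ different packet weights, the algorithm MIX-R is $1/\bigl(1-(1-\frac1s)^s\bigr)$-competitive against an adaptive adversary. That is, for every adaptive adversary that only creates instances $I$ of one of these two kinds, and every answering entity $\mathrm{ADV}$, $$\mathbb{E}[\mathcal{G}_{\text{MIX-R}}(I)]\ \ge\ \Bigl(1-\bigl(1-\tfrac1s\bigr)^s\Bigr)\cdot\mathbb{E}[\mathcal{G}_{\mathrm{ADV}}(I)].$$ In particular, MIX-R is $\frac43$-competitive against an adaptive adversary on $2$-bounded instances.
   Context: **Problem (buffer management with bounded delay).** Time is divided into unit steps; step $t$ corresponds to the interval $(t,t+1)$. A packet is $(w,d)$ with weight $w>0$ and relative deadline $d$ (a positive integer at injection), the number of steps after which it expires; distinct packets may have equal weight and deadline. Buffers are initially empty. Before each step any finite set of packets may be injected, into both the algorithm's and $\mathrm{ADV}$'s buffers. In step $t$ the algorithm and $\mathrm{ADV}$ independently each choose and transmit at most one packet from their own buffer; a transmitted packet is removed from the buffer of the party that transmitted it. At time $t+1$ the relative deadlines of all remaining packets are decremented by $1$, packets whose relative deadline reaches $0$ expire and are removed from both buffers, and then the adversary injects any finite set of packets and step $t+1$ begins. A packet is pending for a party if it has been released and has neither expired nor been transmitted by that party. The gain $\mathcal{G}_X(I)$ of $X$ on instance $I$ (the sequence of injected packets) is the total weight of packets transmitted by $X$. **Restricted instances.** The lifespan of a packet is its relative deadline upon injection. An instance is $s$-bounded if the lifespan of each packet is at most $s$.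 An instance has at most $s$ different packet weights if the set of weights of all its packets has at most $s$ elements. **Adaptive(-online) adversary.** The packets injected at a given time may depend on the algorithm's (random) behavior up to that time. The adversary also provides an answering entity $\mathrm{ADV}$ that creates its own solution in parallel with the algorithm and cannot change it afterwards: its transmission in step $t$ is chosen without knowledge of the algorithm's random choice in step $t$ or later. $\mathrm{ADV}$ is deterministic (without loss of generality), but since the algorithm is randomized, so is $I$. An algorithm $\mathrm{ALG}$ is $R$-competitive against an adaptive adversary (on a class of instances) if for any adaptively created instance $I$ (of that class) and any answering entity $\mathrm{ADV}$, $\mathbb{E}[\mathcal{G}_{\mathrm{ALG}}(I)]\ge \frac1R\,\mathbb{E}[\mathcal{G}_{\mathrm{ADV}}(I)]$ (no additive constant). **Dominance.** A pending packet $a=(w_a,d_a)$ is dominated by a pending packet $b=(w_b,d_b)$ if $w_a\le w_b$ and $d_a\ge d_b$; it is strictly dominated by $b$ if moreover one of these inequalities is strict. A packet is (strictly) dominated if some pending packet (strictly) dominates it. **Algorithm MIX-R (one step).** If there are no pending packets, do nothing. Otherwise set $m\leftarrow 0$, $n\leftarrow 0$, $r\leftarrow 1$, $H_0\leftarrow$ the set of packets pending for the algorithm, and $h_0=(w_0,d_0)\leftarrow$ a heaviest packet of $H_0$. While $H_m\neq\emptyset$, do: 1. $m\leftarrow m+1$; 2. $h_m=(w_m,d_m)\leftarrow$ a heaviest not strictly dominated packet from $H_{m-1}$; 3. $p_{m-1}\leftarrow\min\{1-\frac{w_m}{w_{m-1}},\,r\}$; 4. $r\leftarrow r-p_{m-1}$;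 5. if $r>0$ then $n\leftarrow n+1$; 6. $H_m\leftarrow\{x\in H_{m-1} : x\text{ is not dominated by }h_m\}$. After the loop set $p_m\leftarrow r$. Transmit a packet chosen (with fresh randomness) from $h_1,\dots,h_n$ with probability distribution $p_1,\dots,p_n$. (Always $p_0=0$.) *)

theory Defs
  imports "HOL-Probability.Probability" "HOL-Library.While_Combinator"
begin

section \<open>Packets and instances\<close>

text \<open>
  The adversary injects a finite list of pairs (weight, lifespan) before each step \<open>t\<close>.
  The order within a list carries no meaning: the pair \<open>(t, i)\<close> of injection time and position
  serves as the identity of a packet, so that distinct packets may agree in weight and deadline.
\<close>

type_synonym inst = "nat \<Rightarrow> (real \<times> nat) list"

type_synonym packet = "nat \<times> nat"

definition weight :: "inst \<Rightarrow> packet \<Rightarrow> real" where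
  "weight I p = fst (I (fst p) ! snd p)"

definition lifespan :: "inst \<Rightarrow> packet \<Rightarrow> nat" where
  "lifespan I p = snd (I (fst p) ! snd p)"

definition rel_deadline :: "inst \<Rightarrow> nat \<Rightarrow> packet \<Rightarrow> nat" where
  "rel_deadline I t p = fst p + lifespan I p - t"

definition valid_inst :: "inst \<Rightarrow> bool" where
  "valid_inst I \<longleftrightarrow> (\<forall>t. \<forall>(w, d)\<in>set (I t). w > 0 \<and> d > 0)"

definition bounded_inst :: "nat \<Rightarrow> inst \<Rightarrow> bool" where
  "bounded_inst s I \<longleftrightarrow> (\<forall>t. \<forall>(w, d)\<in>set (I t). d \<le> s)"

definition few_weights :: "nat \<Rightarrow> inst \<Rightarrow> bool" where
  "few_weights s I \<longleftrightarrow>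
     finite (\<Union>t. fst ` set (I t)) \<and> card (\<Union>t. fst ` set (I t)) \<le> s"

section \<open>Schedules\<close>

text \<open>
  A history lists what one party did in steps \<open>0, \<dots>, t - 1\<close>; its length is the current time \<open>t\<close>.
\<close>

type_synonym history = "packet option list"

definition pending :: "inst \<Rightarrow> history \<Rightarrow> packet set" where
  "pending I xs =
     {p. fst p \<le> length xs \<and> snd p < length (I (fst p)) \<and>
         length xs < fst p + lifespan I p \<and> Some p \<notin> set xs}"

definition feasible :: "inst \<Rightarrow> (nat \<Rightarrow> packet option) \<Rightarrow> bool" where
  "feasible I x \<longleftrightarrow> (\<forall>t p. x t = Some p \<longrightarrow> p \<in> pending I (map x [0..<t]))"

definition gain :: "inst \<Rightarrow> (nat \<Rightarrow> packet option) \<Rightarrow> ennreal" where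
  "gain I x = (\<Sum>t. case x t of None \<Rightarrow> 0 | Some p \<Rightarrow> ennreal (weight I p))"

section \<open>Competitiveness against an adaptive adversary\<close>

text \<open>
  A randomized algorithm maps the packets injected so far and its own history to a distribution
  of its next transmission. An adaptive adversary consists of \<open>inject\<close> and \<open>adv\<close>, which determine the
  packets injected before step \<open>t\<close> and ADV's transmission in step \<open>t\<close> from the algorithm's
  transmissions in steps \<open>0, \<dots>, t - 1\<close>.
\<close>

type_synonym algorithm = "inst \<Rightarrow> history \<Rightarrow> packet option pmf"

definition revealed :: "(history \<Rightarrow> (real \<times> nat) list) \<Rightarrow> history \<Rightarrow> inst" where
  "revealed inject xs = (\<lambda>t. if t \<le> length xs then inject (take t xs) else [])"

text \<open>
  Fresh randomness: an outcome \<open>\<omega>\<close> holds, for each conceivable history \<open>xs\<close>, an independent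
  decision \<open>\<omega> xs\<close> that the algorithm takes if \<open>xs\<close> is what it has done so far. A history never
  recurs in a run, so no decision is used twice.
\<close>

definition run_space ::
    "algorithm \<Rightarrow> (history \<Rightarrow> (real \<times> nat) list) \<Rightarrow> (history \<Rightarrow> packet option) measure" where
  "run_space alg inject = (\<Pi>\<^sub>M xs\<in>UNIV. measure_pmf (alg (revealed inject xs) xs))"

primrec run_history :: "(history \<Rightarrow> packet option) \<Rightarrow> nat \<Rightarrow> history" where
  "run_history \<omega> 0 = []"
| "run_history \<omega> (Suc t) = run_history \<omega> t @ [\<omega> (run_history \<omega> t)]"

definition run_inst ::
    "(history \<Rightarrow> (real \<times> nat) list) \<Rightarrow> (history \<Rightarrow> packet option) \<Rightarrow> inst" where
  "run_inst inject \<omega> = (\<lambda>t. inject (run_history \<omega> t))"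

definition alg_schedule :: "(history \<Rightarrow> packet option) \<Rightarrow> nat \<Rightarrow> packet option" where
  "alg_schedule \<omega> = (\<lambda>t. \<omega> (run_history \<omega> t))"

definition adv_schedule ::
    "(history \<Rightarrow> packet option) \<Rightarrow> (history \<Rightarrow> packet option) \<Rightarrow> nat \<Rightarrow> packet option" where
  "adv_schedule adv \<omega> = (\<lambda>t. adv (run_history \<omega> t))"

definition competitive_adaptive :: "real \<Rightarrow> (inst \<Rightarrow> bool) \<Rightarrow> algorithm \<Rightarrow> bool" where
  "competitive_adaptive R C alg \<longleftrightarrow>
     (\<forall>inject adv.
        (AE \<omega> in run_space alg inject.
           valid_inst (run_inst inject \<omega>) \<and> C (run_inst inject \<omega>) \<and>
           feasible (run_inst inject \<omega>) (adv_schedule adv \<omega>)) \<longrightarrow>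
        (\<integral>\<^sup>+\<omega>. gain (run_inst inject \<omega>) (alg_schedule \<omega>) \<partial>run_space alg inject)
          \<ge> ennreal (1 / R) *
            (\<integral>\<^sup>+\<omega>. gain (run_inst inject \<omega>) (adv_schedule adv \<omega>) \<partial>run_space alg inject))"

section \<open>The algorithm MIX-R\<close>

definition dominated :: "('p \<Rightarrow> real) \<Rightarrow> ('p \<Rightarrow> nat) \<Rightarrow> 'p \<Rightarrow> 'p \<Rightarrow> bool" where
  "dominated w d a b \<longleftrightarrow> w a \<le> w b \<and> d a \<ge> d b"

definition strictly_dominated :: "('p \<Rightarrow> real) \<Rightarrow> ('p \<Rightarrow> nat) \<Rightarrow> 'p \<Rightarrow> 'p \<Rightarrow> bool" where
  "strictly_dominated w d a b \<longleftrightarrow> dominated w d a b \<and> (w a < w b \<or> d a > d b)"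

definition heaviest :: "('p \<Rightarrow> real) \<Rightarrow> 'p set \<Rightarrow> 'p set" where
  "heaviest w A = {x\<in>A. \<forall>y\<in>A. w y \<le> w x}"

text \<open>
  One step of MIX-R on the nonempty set \<open>H0\<close> of pending packets; \<open>pick\<close> resolves the choice of
  ``a heaviest packet''. The primed variables are the values after one pass of the loop, except
  that the loop's \<open>p\<close>-index lags behind: pass \<open>m'\<close> sets \<open>p (m' - 1)\<close>, that is \<open>p m\<close>.
\<close>

definition mix_r_step ::
    "('p set \<Rightarrow> 'p) \<Rightarrow> ('p \<Rightarrow> real) \<Rightarrow> ('p \<Rightarrow> nat) \<Rightarrow> 'p set \<Rightarrow> 'p pmf" where
  "mix_r_step pick w d H0 =
     (let (m, n, r, H, h, p) =
        while (\<lambda>(m, n, r, H, h, p). H \<noteq> {})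
          (\<lambda>(m, n, r, H, h, p).
             let m' = m + 1;
                 hm = pick (heaviest w {x\<in>H. \<not> (\<exists>b\<in>H0. strictly_dominated w d x b)});
                 pm = min (1 - w hm / w (h m)) r;
                 r' = r - pm;
                 n' = (if r' > 0 then n + 1 else n);
                 H' = {x\<in>H. \<not> dominated w d x hm}
             in (m', n', r', H', h(m' := hm), p(m := pm)))
          (0::nat, 0::nat, 1::real, H0, (\<lambda>_::nat. pick (heaviest w H0)), (\<lambda>_::nat. 0::real));
        p' = p(m := r)
      in pmf_of_list (map (\<lambda>k. (h k, p' k)) [1..<n + 1]))"

text \<open>
  Ties may be broken in any way, depending on everything the algorithm has seen.
\<close>

type_synonym tie_rule = "inst \<Rightarrow> history \<Rightarrow> packet set \<Rightarrow> packet"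

definition tie_breaking :: "tie_rule \<Rightarrow> bool" where
  "tie_breaking tie \<longleftrightarrow> (\<forall>I xs A. A \<noteq> {} \<longrightarrow> tie I xs A \<in> A)"

definition mix_r :: "tie_rule \<Rightarrow> algorithm" where
  "mix_r tie I xs =
     (if pending I xs = {} then return_pmf None
      else map_pmf Some
        (mix_r_step (tie I xs) (weight I) (rel_deadline I (length xs)) (pending I xs)))"

end

theory Submission
  imports Defs
begin

text \<open>
  Write \<open>w k\<close> for the weight of \<open>h k\<close>. The probabilities are such that
  \<open>w k + (\<Sum>i<k. p i * w i) \<le> w 1\<close> for all \<open>k\<close>, with equality for \<open>k \<le> n\<close>, and the algorithm
  gains \<open>w 1 * (1 - (\<Prod>i\<le>n. 1 - p i)) \<ge> w 1 * (1 - (1 - 1/n) ^ n)\<close> in expectation.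
  Pretend that ADV has the algorithm's buffer. If it sends a packet dominated by \<open>h k\<close> while the
  algorithm sends \<open>h i\<close>, then for \<open>i \<ge> k\<close> ADV only profits from holding its packet of later deadline
  instead of \<open>h i\<close> once it is credited \<open>w k\<close> in total, and for \<open>i < k\<close> it is compensated for the loss
  of \<open>h i\<close> by \<open>w i\<close>. So ADV's expected amortized gain is at most \<open>w 1\<close>. The bookkeeping of these
  exchanges is a potential: the cheapest deadline-respecting matching of ADV's buffer into the
  algorithm's, where a packet pays the weight by which it exceeds its partner. The number \<open>n\<close> is
  at most \<open>s\<close> because weights and deadlines of \<open>h 1, h 2, \<dots>\<close> strictly decrease.
\<close>

section \<open>Real sequences\<close>

text \<open>Arithmetic-geometric mean inequality: padding the \<open>n\<close> factors with
  \<open>s - n\<close> ones gives \<open>s\<close> factors of sum \<open>s - 1\<close>, hence of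
  mean \<open>1 - 1/s\<close>.\<close>

lemma prod_one_minus_le:
  fixes p :: "nat \<Rightarrow> real"
  assumes "n \<le> s" "1 \<le> n" and p0: "\<And>i. i \<in> {1..n} \<Longrightarrow> 0 \<le> p i" and p1: "(\<Sum>i=1..n. p i) = 1"
  shows "(\<Prod>i=1..n. 1 - p i) \<le> (1 - 1 / real s) ^ s"
proof -
  define q where "q i = (if i \<le> n then 1 - p i else 1)" for i
  have s: "s \<ge> 1" using assms by simp
  have split: "{1..s} = {1..n} \<union> {n<..s}" using assms by auto
  have le1: "p i \<le> 1" if "i \<in> {1..n}" for i
    using member_le_sum[of i "{1..n}" p] that p0 p1 by auto
  have q0: "q i \<ge> 0" if "i \<in> {1..s}" for i
    using that le1 by (auto simp: q_def)
  have "(\<Prod>i=1..s. q i) = (\<Prod>i=1..n. q i) * (\<Prod>i\<in>{n<..s}. q i)"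
    unfolding split by (rule prod.union_disjoint) auto
  then have prod_q: "(\<Prod>i=1..s. q i) = (\<Prod>i=1..n. 1 - p i)"
    by (simp add: q_def)
  have "(\<Sum>i=1..s. q i) = (\<Sum>i=1..n. q i) + (\<Sum>i\<in>{n<..s}. q i)"
    unfolding split by (rule sum.union_disjoint) auto
  also have "\<dots> = (real n - 1) + real (s - n)"
    using p1 by (simp add: q_def sum_subtractf)
  finally have sum_q: "(\<Sum>i=1..s. q i) = real s - 1"
    using assms by (simp add: of_nat_diff)
  have "root s x = x powr (1 / real s)" if "x \<ge> 0" for x
    using that s by (cases "x = 0") (auto simp: root_powr_inverse)
  moreover have "0 \<le> (\<Prod>i=1..s. q i)"
    using q0 by (intro prod_nonneg) auto
  ultimately have "root s (\<Prod>i=1..s. q i) \<le> (\<Sum>i=1..s. q i) / real s"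
    using arith_geom_mean[of "{1..s}" q] s q0
    by (simp flip: sum_divide_distrib)
  also have "\<dots> = 1 - 1 / real s"
    unfolding sum_q using s by (simp add: field_simps)
  finally have le: "root s (\<Prod>i=1..s. q i) \<le> 1 - 1 / real s" .
  have "(\<Prod>i=1..s. q i) = root s (\<Prod>i=1..s. q i) ^ s"
    using s q0 by (intro real_root_pow_pos2[symmetric] prod_nonneg) auto
  also have "\<dots> \<le> (1 - 1 / real s) ^ s"
    using le q0 by (intro power_mono real_root_ge_zero prod_nonneg) auto
  finally show ?thesis unfolding prod_q .
qed

text \<open>The hypothesis reads \<open>p i * v i = v i - v (Suc i)\<close>, so the sum telescopes;
  unrolling the recursion gives the product.\<close>

lemma sum_telescope_ratio:
  fixes p v :: "nat \<Rightarrow> real"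
  assumes "1 \<le> k" and "\<And>i. 1 \<le> i \<Longrightarrow> i < k \<Longrightarrow> v i * (1 - p i) = v (Suc i)"
  shows "v k + (\<Sum>i=1..<k. p i * v i) = v 1" and "v k = v 1 * (\<Prod>i=1..<k. 1 - p i)"
proof -
  obtain j where k: "k = Suc j" using assms(1) by (cases k) auto
  have "v (Suc l) + (\<Sum>i=1..<Suc l. p i * v i) = v 1 \<and> v (Suc l) = v 1 * (\<Prod>i=1..<Suc l. 1 - p i)"
    if "l \<le> j" for l
    using that
  proof (induction l)
    case (Suc l)
    then have "v (Suc l) * (1 - p (Suc l)) = v (Suc (Suc l))"
      using assms(2)[of "Suc l"] k by simp
    with Suc show ?case by (simp add: algebra_simps)
  qed simp
  from this[of j] k show "v k + (\<Sum>i=1..<k. p i * v i) = v 1" "v k = v 1 * (\<Prod>i=1..<k. 1 - p i)"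
    by blast+
qed

section \<open>The packets and probabilities computed in one step\<close>

text \<open>
  The loop of MIX-R passes through \<open>h 1, \<dots>, h m\<close>; the transmitted packet is \<open>h k\<close> with
  probability \<open>p k\<close>, \<open>1 \<le> k \<le> n\<close>. If \<open>n < m\<close>, the probability mass ran out at \<open>h n\<close>.
\<close>

locale mix_chain =
  fixes w :: "'p \<Rightarrow> real" and d :: "'p \<Rightarrow> nat" and A :: "'p set"
    and m n :: nat and h :: "nat \<Rightarrow> 'p" and p :: "nat \<Rightarrow> real"
  assumes n_pos: "1 \<le> n" and n_le: "n \<le> m"
    and w_pos: "x \<in> A \<Longrightarrow> 0 < w x"
    and h_in: "k \<in> {1..m} \<Longrightarrow> h k \<in> A"
    and h_deadline: "1 \<le> i \<Longrightarrow> i < j \<Longrightarrow> j \<le> m \<Longrightarrow> d (h j) < d (h i)"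
    and h_weight: "1 \<le> i \<Longrightarrow> i < j \<Longrightarrow> j \<le> m \<Longrightarrow> w (h j) < w (h i)"
    and h_dominates: "x \<in> A \<Longrightarrow> \<exists>k\<in>{1..m}. dominated w d x (h k)"
    and p_nonneg: "i \<in> {1..n} \<Longrightarrow> 0 \<le> p i"
    and p_sum: "(\<Sum>i=1..n. p i) = 1"
    and p_ratio: "1 \<le> i \<Longrightarrow> i < n \<Longrightarrow> p i = 1 - w (h (Suc i)) / w (h i)"
    and p_last: "n < m \<Longrightarrow> p n \<le> 1 - w (h (Suc n)) / w (h n)"
begin

lemma h_pos: "k \<in> {1..m} \<Longrightarrow> 0 < w (h k)"
  using h_in w_pos by blast

lemma p_weight: "1 \<le> i \<Longrightarrow> i < n \<Longrightarrow> w (h i) * (1 - p i) = w (h (Suc i))"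
  using p_ratio[of i] h_pos[of i] n_le by (simp add: field_simps)

lemma weight_le_first: "k \<in> {1..m} \<Longrightarrow> w (h k) \<le> w (h 1)"
  using h_weight[of 1 k] by (cases "k = 1") auto

text \<open>Read as a charge: a packet of ADV charged to \<open>h k\<close> earns
  \<open>w (h k)\<close>, plus \<open>w (h i)\<close> whenever the algorithm sends an
  \<open>h i\<close> with \<open>i < k\<close>. The telescoping sum gives equality for
  \<open>k \<le> n\<close>.\<close>

lemma advantage_le_first:
  assumes "k \<in> {1..m}"
  shows "w (h k) + (\<Sum>i=1..n. p i * (if i < k then w (h i) else 0)) \<le> w (h 1)"
proof (cases "k \<le> n")
  case True
  have "(\<Sum>i=1..n. p i * (if i < k then w (h i) else 0)) = (\<Sum>i=1..<k. p i * w (h i))"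
    using True by (intro sum.mono_neutral_cong_right) auto
  then show ?thesis
    using sum_telescope_ratio(1)[of k "\<lambda>i. w (h i)" p] p_weight True assms by simp
next
  case False
  \<comment> \<open>All \<open>i \<le> n\<close> are below \<open>k\<close>. The mass ran out at
    \<open>h n\<close>, and by \<open>p_last\<close> the remainder
    \<open>w (h n) * (1 - p n)\<close> is at least \<open>w (h (Suc n))\<close>, hence at least
    \<open>w (h k)\<close>.\<close>
  have "(\<Sum>i=1..n. p i * (if i < k then w (h i) else 0)) = (\<Sum>i=1..n. p i * w (h i))"
    using False by (intro sum.cong) auto
  also have "\<dots> = (\<Sum>i=1..<n. p i * w (h i)) + p n * w (h n)"
    using n_pos by (simp add: sum.last_plus)
  finally have 1: "(\<Sum>i=1..n. p i * (if i < k then w (h i) else 0))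
      = (\<Sum>i=1..<n. p i * w (h i)) + p n * w (h n)" .
  have 2: "w (h n) + (\<Sum>i=1..<n. p i * w (h i)) = w (h 1)"
    using sum_telescope_ratio(1)[of n "\<lambda>i. w (h i)" p] p_weight n_pos by simp
  have 3: "w (h k) \<le> w (h (Suc n))"
    using h_weight[of "Suc n" k] False assms by (cases "k = Suc n") auto
  have 4: "p n * w (h n) \<le> w (h n) - w (h (Suc n))"
    using p_last h_pos[of n] False assms n_pos by (simp add: field_simps)
  show ?thesis using 1 2 3 4 by linarith
qed

text \<open>The expected weight equals \<open>w (h 1) * (1 - (\<Prod>i=1..n. 1 - p i))\<close>: the
  telescoped identity up to \<open>n\<close>, extended by the last factor \<open>1 - p n\<close>.
  Then \<open>prod_one_minus_le\<close> applies.\<close>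

lemma expected_weight_ge:
  assumes "n \<le> s"
  shows "(1 - (1 - 1 / real s) ^ s) * w (h 1) \<le> (\<Sum>i=1..n. p i * w (h i))"
proof -
  have v: "w (h n) + (\<Sum>i=1..<n. p i * w (h i)) = w (h 1)"
    "w (h n) = w (h 1) * (\<Prod>i=1..<n. 1 - p i)"
    using sum_telescope_ratio[of n "\<lambda>i. w (h i)" p] p_weight n_pos by simp_all
  have "(\<Prod>i=1..n. 1 - p i) = (\<Prod>i=1..<n. 1 - p i) * (1 - p n)"
    using n_pos by (simp add: prod.last_plus)
  moreover have "(\<Sum>i=1..n. p i * w (h i)) = (\<Sum>i=1..<n. p i * w (h i)) + p n * w (h n)"
    using n_pos by (simp add: sum.last_plus)
  moreover have "w (h n) * (1 - p n) = w (h n) - p n * w (h n)"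
    by (simp add: algebra_simps)
  ultimately have "(\<Sum>i=1..n. p i * w (h i)) = w (h 1) - w (h 1) * (\<Prod>i=1..n. 1 - p i)"
    using v by simp
  also have "\<dots> = w (h 1) * (1 - (\<Prod>i=1..n. 1 - p i))"
    by (simp add: algebra_simps)
  also have "\<dots> \<ge> w (h 1) * (1 - (1 - 1 / real s) ^ s)"
    using prod_one_minus_le[OF assms n_pos p_nonneg p_sum] h_pos[of 1] n_pos n_le
    by (intro mult_left_mono) auto
  finally show ?thesis by (simp add: mult.commute)
qed

lemma h_inj: "inj_on h {1..m}"
proof (rule linorder_inj_onI')
  fix i j assume "i \<in> {1..m}" "j \<in> {1..m}" "i < j"
  then show "h i \<noteq> h j" using h_weight[of i j] by auto
qed

text \<open>Strict decrease makes the deadlines of \<open>h 1, ..., h m\<close> distinct elements of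
  \<open>{1..s}\<close>, so even \<open>m \<le> s\<close>.\<close>

lemma n_le_deadlines:
  assumes "\<And>x. x \<in> A \<Longrightarrow> 0 < d x \<and> d x \<le> s"
  shows "n \<le> s"
proof -
  have "inj_on (\<lambda>i. d (h i)) {1..m}"
  proof (rule linorder_inj_onI')
    fix i j assume "i \<in> {1..m}" "j \<in> {1..m}" "i < j"
    then show "d (h i) \<noteq> d (h j)" using h_deadline[of i j] by auto
  qed
  moreover have "(\<lambda>i. d (h i)) ` {1..m} \<subseteq> {1..s}"
    using assms[OF h_in] by (auto simp: Suc_le_eq)
  ultimately have "card {1..m} \<le> card {1..s}"
    by (intro card_inj_on_le) auto
  then show ?thesis using n_le by simp
qed

lemma n_le_weights:
  assumes "w ` A \<subseteq> W" "finite W" "card W \<le> s"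
  shows "n \<le> s"
proof -
  have "inj_on (\<lambda>i. w (h i)) {1..m}"
  proof (rule linorder_inj_onI')
    fix i j assume "i \<in> {1..m}" "j \<in> {1..m}" "i < j"
    then show "w (h i) \<noteq> w (h j)" using h_weight[of i j] by auto
  qed
  moreover have "(\<lambda>i. w (h i)) ` {1..m} \<subseteq> W"
    using assms(1) h_in by auto
  ultimately have "card {1..m} \<le> card W"
    using assms(2) by (intro card_inj_on_le) auto
  then show ?thesis using n_le assms(3) by simp
qed

section \<open>The distribution of the transmitted packet\<close>

lemma pmf_of_list_wf_chain: "pmf_of_list_wf (map (\<lambda>k. (h k, p k)) [1..<n + 1])"
proof (rule pmf_of_list_wfI)
  show "sum_list (map snd (map (\<lambda>k. (h k, p k)) [1..<n + 1])) = 1"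
    using p_sum by (simp add: comp_def interv_sum_list_conv_sum_set_nat atLeastLessThanSuc_atLeastAtMost del: upt_Suc)
qed (use p_nonneg in auto)

lemma set_pmf_chain: "set_pmf (pmf_of_list (map (\<lambda>k. (h k, p k)) [1..<n + 1])) \<subseteq> h ` {1..n}"
  using set_pmf_of_list[OF pmf_of_list_wf_chain] by (auto simp del: upt_Suc)

text \<open>\<open>pmf_of_list\<close> adds up the entries of equal packets; injectivity of
  \<open>h\<close> leaves a single one.\<close>

lemma pmf_chain:
  assumes "k \<in> {1..n}"
  shows "pmf (pmf_of_list (map (\<lambda>k. (h k, p k)) [1..<n + 1])) (h k) = p k"
proof -
  have *: "h i = h k \<longleftrightarrow> i = k" if "i \<in> {1..n}" for i
    using inj_on_eq_iff[OF h_inj, of i k] that assms n_le by auto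
  have "pmf (pmf_of_list (map (\<lambda>k. (h k, p k)) [1..<n + 1])) (h k)
      = sum_list (map p (filter (\<lambda>i. h i = h k) [1..<n + 1]))"
    unfolding pmf_pmf_of_list[OF pmf_of_list_wf_chain] by (simp add: filter_map comp_def del: upt_Suc)
  also have "\<dots> = (\<Sum>i\<in>{i\<in>{1..n}. h i = h k}. p i)"
    by (subst sum_list_distinct_conv_sum_set) (auto intro!: sum.cong simp del: upt_Suc)
  also have "{i\<in>{1..n}. h i = h k} = {k}"
    using * assms by auto
  finally show ?thesis by simp
qed

lemma nn_integral_chain:
  "(\<integral>\<^sup>+x. f x \<partial>measure_pmf (pmf_of_list (map (\<lambda>k. (h k, p k)) [1..<n + 1])))
     = (\<Sum>i=1..n. ennreal (p i) * f (h i))"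
proof -
  let ?P = "pmf_of_list (map (\<lambda>k. (h k, p k)) [1..<n + 1])"
  have "(\<integral>\<^sup>+x. f x \<partial>measure_pmf ?P) = (\<Sum>x\<in>h ` {1..n}. f x * ennreal (pmf ?P x))"
    using set_pmf_chain by (intro nn_integral_measure_pmf_support) (auto simp: set_pmf_eq simp del: upt_Suc)
  also have "\<dots> = (\<Sum>i=1..n. f (h i) * ennreal (pmf ?P (h i)))"
    using inj_on_subset[OF h_inj, of "{1..n}"] n_le by (subst sum.reindex) (auto simp: comp_def simp del: upt_Suc)
  also have "\<dots> = (\<Sum>i=1..n. ennreal (p i) * f (h i))"
    using pmf_chain by (intro sum.cong) (auto simp: mult.commute simp del: upt_Suc)
  finally show ?thesis .
qed

end

section \<open>Correctness of the loop\<close>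

lemma heaviest_nonempty:
  assumes "finite A" "A \<noteq> {}"
  shows "heaviest w A \<noteq> {}"
proof -
  have "Max (w ` A) \<in> w ` A"
    using assms by (intro Max_in) auto
  then obtain x where "x \<in> A" "Max (w ` A) = w x" by (elim imageE)
  then have "x \<in> heaviest w A"
    using assms Max_ge[of "w ` A"] by (auto simp: heaviest_def)
  then show ?thesis by blast
qed

text \<open>A heaviest packet of \<open>H\<close> with least deadline works: a packet strictly
  dominating it would lie in \<open>H\<close> by closedness, have the same weight and an earlier
  deadline. Hence the candidates for \<open>hm\<close> reach the maximal weight of
  \<open>H\<close>.\<close>

lemma ex_heaviest_not_strictly_dominated:
  assumes "finite H" "H \<noteq> {}"
    and closed: "\<And>x b. x \<in> H \<Longrightarrow> b \<in> A \<Longrightarrow> dominated w d x b \<Longrightarrow> b \<in> H"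
  shows "\<exists>x\<in>heaviest w H. \<forall>b\<in>A. \<not> strictly_dominated w d x b"
proof -
  obtain x0 where "x0 \<in> heaviest w H" using heaviest_nonempty[OF assms(1,2)] by blast
  from ex_has_least_nat[of "\<lambda>x. x \<in> heaviest w H", OF this, of d]
  obtain x where x: "x \<in> heaviest w H" "\<And>y. y \<in> heaviest w H \<Longrightarrow> d x \<le> d y"
    by blast
  have "\<not> strictly_dominated w d x b" if "b \<in> A" for b
  proof
    assume sd: "strictly_dominated w d x b"
    have "b \<in> H" using closed[of x b] x(1) that sd by (auto simp: strictly_dominated_def heaviest_def)
    moreover have "w x \<le> w b" using sd by (auto simp: strictly_dominated_def dominated_def)
    ultimately have "b \<in> heaviest w H" "w b = w x" using x(1) by (force simp: heaviest_def)+
    then show False using sd x(2)[of b] by (auto simp: strictly_dominated_def)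
  qed
  then show ?thesis using x(1) by blast
qed

text \<open>
  While \<open>r > 0\<close>, all passes so far received their full share \<open>1 - w (h (i + 1)) / w (h i)\<close>;
  afterwards \<open>n\<close> stays at the last packet with a positive share.
\<close>

definition mix_invariant ::
    "('p \<Rightarrow> real) \<Rightarrow> ('p \<Rightarrow> nat) \<Rightarrow> 'p set
      \<Rightarrow> nat \<times> nat \<times> real \<times> 'p set \<times> (nat \<Rightarrow> 'p) \<times> (nat \<Rightarrow> real) \<Rightarrow> bool" where
  "mix_invariant w d A = (\<lambda>(m, n, r, H, h, p).
     H = {x\<in>A. \<forall>k\<in>{1..m}. \<not> dominated w d x (h k)} \<and>
     h 0 \<in> A \<and> (\<forall>k\<in>{1..m}. h k \<in> A \<and> \<not> (\<exists>b\<in>A. strictly_dominated w d (h k) b)) \<and>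
     (m > 0 \<longrightarrow> w (h 1) = w (h 0)) \<and> (\<forall>x\<in>H. w x \<le> w (h m)) \<and>
     (\<forall>i j. 1 \<le> i \<longrightarrow> i < j \<longrightarrow> j \<le> m \<longrightarrow> d (h j) < d (h i) \<and> w (h j) < w (h i)) \<and>
     (\<forall>i<n. 0 \<le> p i) \<and>
     (\<forall>i. 1 \<le> i \<longrightarrow> i < n \<longrightarrow> p i = 1 - w (h (Suc i)) / w (h i)) \<and>
     (r > 0 \<and> n = m \<and> (\<Sum>i=1..<m. p i) = 1 - r \<or>
      r = 0 \<and> 1 \<le> n \<and> n < m \<and> 0 \<le> p n \<and> (\<Sum>i=1..n. p i) = 1 \<and>
        p n \<le> 1 - w (h (Suc n)) / w (h n)))"

text \<open>The chain decreases strictly because \<open>hm\<close> survived the removal of the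
  packets dominated by \<open>h m\<close>, while \<open>h m\<close> was itself not strictly
  dominated.\<close>

lemma mix_invariant_step:
  fixes pick :: "'p set \<Rightarrow> 'p"
  assumes pick: "\<And>B. B \<noteq> {} \<Longrightarrow> pick B \<in> B"
    and finA: "finite A" and pos: "\<And>x. x \<in> A \<Longrightarrow> 0 < w x"
    and h0: "h 0 \<in> heaviest w A" and ne: "H \<noteq> {}"
    and inv: "mix_invariant w d A (m, n, r, H, h, p)"
  defines "hm \<equiv> pick (heaviest w {x\<in>H. \<not> (\<exists>b\<in>A. strictly_dominated w d x b)})"
  defines "pm \<equiv> min (1 - w hm / w (h m)) r"
  shows "mix_invariant w d A
      (m + 1, (if r - pm > 0 then n + 1 else n), r - pm, {x\<in>H. \<not> dominated w d x hm}, h(m + 1 := hm), p(m := pm))"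
    and "hm \<in> H"
proof -
  note inv = inv[unfolded mix_invariant_def prod.case]
  have H: "H = {x\<in>A. \<forall>k\<in>{1..m}. \<not> dominated w d x (h k)}" using inv by blast
  have hA: "h k \<in> A" if "k \<le> m" for k
    using that inv by (cases "k = 0") auto
  have nsd: "\<not> strictly_dominated w d (h k) b" if "k \<in> {1..m}" "b \<in> A" for k b
    using that inv by blast
  have w_le: "w x \<le> w (h m)" if "x \<in> H" for x using that inv by blast
  have dec: "d (h j) < d (h i) \<and> w (h j) < w (h i)" if "1 \<le> i" "i < j" "j \<le> m" for i j
    using that inv by blast
  have closed: "b \<in> H" if "x \<in> H" "b \<in> A" "dominated w d x b" for x b
    using that unfolding H by (force simp: dominated_def)
  have "finite H" using finA H by auto
  then obtain y where y: "y \<in> heaviest w H" "\<forall>b\<in>A. \<not> strictly_dominated w d y b"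
    using ex_heaviest_not_strictly_dominated[of H A w d] ne closed by blast
  then have "heaviest w {x\<in>H. \<not> (\<exists>b\<in>A. strictly_dominated w d x b)} \<noteq> {}"
    using \<open>finite H\<close> by (intro heaviest_nonempty) (auto simp: heaviest_def)
  from pick[OF this] have hm_heaviest:
    "hm \<in> heaviest w {x\<in>H. \<not> (\<exists>b\<in>A. strictly_dominated w d x b)}"
    by (simp only: hm_def)
  then show hmH: "hm \<in> H" by (auto simp: heaviest_def)
  have hm: "hm \<in> A" "\<And>b. b \<in> A \<Longrightarrow> \<not> strictly_dominated w d hm b"
    using hm_heaviest H by (auto simp: heaviest_def)
  \<comment> \<open>\<open>y\<close> is a candidate of maximal weight in \<open>H\<close>, so
    excluding strictly dominated packets does not lower the maximum.\<close>
  have hm_max: "w x \<le> w hm" if "x \<in> H" for x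
  proof -
    have "y \<in> H" "w x \<le> w y" using y(1) that by (auto simp: heaviest_def)
    moreover from this have "w y \<le> w hm" using y(2) hm_heaviest unfolding heaviest_def by blast
    ultimately show ?thesis by simp
  qed
  have new: "d hm < d (h m) \<and> w hm < w (h m)" if "m > 0"
  proof -
    have "\<not> dominated w d hm (h m)" using hmH that unfolding H by auto
    then have "d hm < d (h m)" using w_le[OF hmH] by (auto simp: dominated_def)
    moreover have "w hm \<noteq> w (h m)"
      using nsd[of m hm] that hm(1) \<open>d hm < d (h m)\<close> by (auto simp: strictly_dominated_def dominated_def)
    ultimately show ?thesis using w_le[OF hmH] by simp
  qed
  \<comment> \<open>In the first pass \<open>H = A\<close>, and \<open>h 0\<close> and
    \<open>hm\<close> are both heaviest. So the share \<open>p 0\<close> is 0 and all mass remains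
    for the packets of the chain.\<close>
  have first: "w hm = w (h 0)" if "m = 0"
  proof -
    have "h 0 \<in> H" using h0 that by (auto simp: H heaviest_def)
    then show ?thesis using hm_max[of "h 0"] w_le[OF hmH] that by auto
  qed
  let ?h = "h(m + 1 := hm)" and ?p = "p(m := pm)"
  have hpos: "0 < w (h m)" "0 < w hm" using pos hA hm(1) by auto
  have ratio_nonneg: "0 \<le> 1 - w hm / w (h m)" using w_le[OF hmH] hpos by simp
  have ratio_less: "1 - w hm / w (h m) < 1" using hpos by simp
  have c1: "{x\<in>H. \<not> dominated w d x hm} = {x\<in>A. \<forall>k\<in>{1..m + 1}. \<not> dominated w d x (?h k)}"
    by (auto simp: H atLeastAtMostSuc_conv)
  have c2: "?h 0 \<in> A \<and> (\<forall>k\<in>{1..m + 1}. ?h k \<in> A \<and> \<not> (\<exists>b\<in>A. strictly_dominated w d (?h k) b))"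
    using hA hm nsd by (auto simp: le_Suc_eq)
  have c3: "m + 1 > 0 \<longrightarrow> w (?h 1) = w (?h 0)"
    using inv first by (cases "m = 0") auto
  have c4: "\<forall>x\<in>{x\<in>H. \<not> dominated w d x hm}. w x \<le> w (?h (m + 1))"
    using hm_max by auto
  have c5: "\<forall>i j. 1 \<le> i \<longrightarrow> i < j \<longrightarrow> j \<le> m + 1 \<longrightarrow> d (?h j) < d (?h i) \<and> w (?h j) < w (?h i)"
  proof (intro allI impI)
    fix i j assume ij: "1 \<le> i" "i < j" "j \<le> m + 1"
    show "d (?h j) < d (?h i) \<and> w (?h j) < w (?h i)"
    proof (cases "j = m + 1")
      case True
      then show ?thesis using ij new dec[of i m] by (cases "i = m") force+
    next
      case False
      then show ?thesis using ij dec[of i j] by auto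
    qed
  qed
  \<comment> \<open>Either mass \<open>r\<close> is left and \<open>n\<close> still follows
    \<open>m\<close>, or it is used up and \<open>n\<close> is frozen.\<close>
  consider (alive) "r > 0" "n = m" "(\<Sum>i=1..<m. p i) = 1 - r"
    | (spent) "r = 0" "1 \<le> n" "n < m" "0 \<le> p n" "(\<Sum>i=1..n. p i) = 1"
        "p n \<le> 1 - w (h (Suc n)) / w (h n)"
    using inv by blast
  then have c6: "(\<forall>i<(if r - pm > 0 then n + 1 else n). 0 \<le> ?p i) \<and>
     (\<forall>i. 1 \<le> i \<longrightarrow> i < (if r - pm > 0 then n + 1 else n) \<longrightarrow> ?p i = 1 - w (?h (Suc i)) / w (?h i)) \<and>
     (r - pm > 0 \<and> (if r - pm > 0 then n + 1 else n) = m + 1 \<and> (\<Sum>i=1..<m + 1. ?p i) = 1 - (r - pm) \<or>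
      r - pm = 0 \<and> 1 \<le> (if r - pm > 0 then n + 1 else n) \<and> (if r - pm > 0 then n + 1 else n) < m + 1
        \<and> 0 \<le> ?p (if r - pm > 0 then n + 1 else n)
        \<and> (\<Sum>i=1..(if r - pm > 0 then n + 1 else n). ?p i) = 1 \<and>
        ?p (if r - pm > 0 then n + 1 else n)
          \<le> 1 - w (?h (Suc (if r - pm > 0 then n + 1 else n))) / w (?h (if r - pm > 0 then n + 1 else n)))"
  proof cases
    case alive
    have pm0: "0 \<le> pm" using ratio_nonneg alive by (simp add: pm_def)
    have old: "(\<forall>i<m. 0 \<le> p i) \<and> (\<forall>i. 1 \<le> i \<longrightarrow> i < m \<longrightarrow> p i = 1 - w (h (Suc i)) / w (h i))"
      using inv alive by blast
    show ?thesis
    proof (cases "r - pm > 0")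
      case True
      then have pm: "pm = 1 - w hm / w (h m)" by (auto simp: pm_def)
      have "(\<Sum>i=1..<m + 1. ?p i) = 1 - (r - pm)"
      proof (cases "m = 0")
        case True
        then show ?thesis using alive pm first hpos by simp
      next
        case False
        then have "(\<Sum>i=1..<m + 1. ?p i) = (\<Sum>i=1..<m. ?p i) + pm" by simp
        also have "(\<Sum>i=1..<m. ?p i) = (\<Sum>i=1..<m. p i)" by (intro sum.cong) auto
        finally show ?thesis using alive by simp
      qed
      then show ?thesis using True alive old pm pm0 by (auto simp: less_Suc_eq)
    next
      case False
      then have pm: "pm = r" "pm \<le> 1 - w hm / w (h m)" by (auto simp: pm_def)
      \<comment> \<open>The first pass has share \<open>1 - w hm / w (h 0) = 0\<close> and so cannot
        exhaust the mass.\<close>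
      have "m \<noteq> 0"
      proof
        assume "m = 0"
        then show False using alive pm first hpos by simp
      qed
      then have "(\<Sum>i=1..m. ?p i) = (\<Sum>i=1..<m. ?p i) + pm" by (simp add: sum.last_plus)
      also have "(\<Sum>i=1..<m. ?p i) = (\<Sum>i=1..<m. p i)" by (intro sum.cong) auto
      finally have "(\<Sum>i=1..m. ?p i) = 1" using alive pm by simp
      then show ?thesis using False alive old pm pm0 \<open>m \<noteq> 0\<close> by auto
    qed
  next
    case spent
    have "pm = 0" using spent ratio_nonneg by (simp add: pm_def)
    moreover have "(\<Sum>i=1..n. ?p i) = (\<Sum>i=1..n. p i)"
      using spent by (intro sum.cong) auto
    moreover have "(\<forall>i<n. 0 \<le> p i) \<and> (\<forall>i. 1 \<le> i \<longrightarrow> i < n \<longrightarrow> p i = 1 - w (h (Suc i)) / w (h i))"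
      using inv by blast
    ultimately show ?thesis using spent by auto
  qed
  show "mix_invariant w d A
      (m + 1, (if r - pm > 0 then n + 1 else n), r - pm, {x\<in>H. \<not> dominated w d x hm}, ?h, ?p)"
    unfolding mix_invariant_def prod.case using c1 c2 c3 c4 c5 c6 by blast
qed

text \<open>If mass is left, then \<open>n = m\<close> and the remainder goes to \<open>h m\<close>,
  which makes the sum 1. Otherwise \<open>r = 0\<close> and \<open>n < m\<close>, so
  \<open>p(m := r)\<close> does not touch the indices up to \<open>n\<close>.\<close>

lemma mix_invariant_final:
  assumes pos: "\<And>x. x \<in> A \<Longrightarrow> 0 < w x" and "A \<noteq> {}"
    and inv: "mix_invariant w d A (m, n, r, {}, h, p)"
  shows "mix_chain w d A m n h (p(m := r))"
proof -
  note inv = inv[unfolded mix_invariant_def prod.case]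
  have dom: "\<exists>k\<in>{1..m}. dominated w d x (h k)" if "x \<in> A" for x
    using inv that by blast
  then have m: "m > 0" using \<open>A \<noteq> {}\<close> by fastforce
  have base: "\<And>k. k \<in> {1..m} \<Longrightarrow> h k \<in> A"
      "\<And>i j. 1 \<le> i \<Longrightarrow> i < j \<Longrightarrow> j \<le> m \<Longrightarrow> d (h j) < d (h i) \<and> w (h j) < w (h i)"
      "\<And>i. i < n \<Longrightarrow> 0 \<le> p i"
      "\<And>i. 1 \<le> i \<Longrightarrow> i < n \<Longrightarrow> p i = 1 - w (h (Suc i)) / w (h i)"
    using inv by blast+
  consider (alive) "r > 0" "n = m" "(\<Sum>i=1..<m. p i) = 1 - r"
    | (spent) "r = 0" "1 \<le> n" "n < m" "0 \<le> p n" "(\<Sum>i=1..n. p i) = 1"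
        "p n \<le> 1 - w (h (Suc n)) / w (h n)"
    using inv by blast
  then show ?thesis
  proof cases
    case alive
    have "(\<Sum>i=1..m. (p(m := r)) i) = (\<Sum>i=1..<m. (p(m := r)) i) + r"
      using m by (simp add: sum.last_plus)
    also have "(\<Sum>i=1..<m. (p(m := r)) i) = (\<Sum>i=1..<m. p i)" by (intro sum.cong) auto
    finally have "(\<Sum>i=1..n. (p(m := r)) i) = 1" using alive by simp
    moreover have "w (h (Suc i)) \<le> w (h i)" if "1 \<le> i" "i < m" for i
      using base(2)[of i "Suc i"] that by auto
    ultimately show ?thesis
      using alive m pos base dom by unfold_locales auto
  next
    case spent
    have "(\<Sum>i=1..n. (p(m := r)) i) = (\<Sum>i=1..n. p i)"
      using spent by (intro sum.cong) auto
    then show ?thesis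
      using spent m pos base dom by unfold_locales (auto simp: le_less)
  qed
qed

text \<open>Each pass removes at least \<open>hm\<close> from \<open>H\<close>, since a packet
  dominates itself. So the loop terminates on a finite set, and the invariant at exit describes the
  chain.\<close>

lemma mix_r_step_chain:
  assumes pick: "\<And>B. B \<noteq> {} \<Longrightarrow> pick B \<in> B"
    and "finite A" "A \<noteq> {}" and pos: "\<And>x. x \<in> A \<Longrightarrow> 0 < w x"
  obtains m n h p where "mix_chain w d A m n h p"
    and "mix_r_step pick w d A = pmf_of_list (map (\<lambda>k. (h k, p k)) [1..<n + 1])"
proof -
  let ?b = "\<lambda>(m, n, r, H, h, p). H \<noteq> {}"
  let ?c = "\<lambda>(m, n, r, H, h, p).
             let m' = m + 1;
                 hm = pick (heaviest w {x\<in>H. \<not> (\<exists>b\<in>A. strictly_dominated w d x b)});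
                 pm = min (1 - w hm / w (h m)) r;
                 r' = r - pm;
                 n' = (if r' > 0 then n + 1 else n);
                 H' = {x\<in>H. \<not> dominated w d x hm}
             in (m', n', r', H', h(m' := hm), p(m := pm))"
  let ?s0 = "(0::nat, 0::nat, 1::real, A, (\<lambda>_::nat. pick (heaviest w A)), (\<lambda>_::nat. 0::real))"
  \<comment> \<open>The conjunct on \<open>h 0\<close> is carried along because
    \<open>mix_invariant_step\<close> needs it for the share of the first pass.\<close>
  let ?inv = "\<lambda>s. mix_invariant w d A s \<and> (case s of (m, n, r, H, h, p) \<Rightarrow> h 0 \<in> heaviest w A)"
  have h0: "pick (heaviest w A) \<in> heaviest w A"
    using pick heaviest_nonempty assms(2,3) by blast
  have "?inv (while ?b ?c ?s0) \<and> \<not> ?b (while ?b ?c ?s0)"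
  proof (rule while_rule2[where r = "Wellfounded.measure (\<lambda>(m, n, r, H, h, p). card H)" and P = ?inv])
    show "?inv ?s0"
      using h0 by (auto simp: mix_invariant_def heaviest_def)
  next
    fix s :: "nat \<times> nat \<times> real \<times> _ set \<times> (nat \<Rightarrow> _) \<times> (nat \<Rightarrow> real)"
    assume inv: "?inv s" and b: "?b s"
    obtain m n r H h p where s: "s = (m, n, r, H, h, p)" by (cases s)
    note step = mix_invariant_step[where pick = pick and A = A and w = w and d = d and h = h and H = H
        and m = m and n = n and r = r and p = p, OF pick assms(2) pos]
    let ?hm = "pick (heaviest w {x\<in>H. \<not> (\<exists>b\<in>A. strictly_dominated w d x b)})"
    have *: "h 0 \<in> heaviest w A" "H \<noteq> {}" "mix_invariant w d A (m, n, r, H, h, p)"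
      using inv b by (auto simp: s)
    have "finite H" using *(3) assms(2) by (auto simp: mix_invariant_def)
    moreover have "{x\<in>H. \<not> dominated w d x ?hm} \<subset> H"
      using step(2)[OF _ _ *] by (auto simp: dominated_def)
    ultimately have "card {x\<in>H. \<not> dominated w d x ?hm} < card H"
      by (rule psubset_card_mono)
    then show "?inv (?c s) \<and> (?c s, s) \<in> Wellfounded.measure (\<lambda>(m, n, r, H, h, p). card H)"
      using step(1)[OF _ _ *] *(1) unfolding s Let_def prod.case by simp
  qed auto
  moreover obtain m n r H h p where fin: "while ?b ?c ?s0 = (m, n, r, H, h, p)"
    using prod_cases6 by blast
  ultimately have "mix_invariant w d A (m, n, r, H, h, p)" "H = {}"
    unfolding fin prod.case by blast+
  then have "mix_invariant w d A (m, n, r, {}, h, p)" by simp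
  from mix_invariant_final[OF pos \<open>A \<noteq> {}\<close> this]
  have "mix_chain w d A m n h (p(m := r))" by simp
  moreover have "mix_r_step pick w d A = pmf_of_list (map (\<lambda>k. (h k, (p(m := r)) k)) [1..<n + 1])"
    unfolding mix_r_step_def fin by simp
  ultimately show ?thesis by (rule that)
qed

section \<open>The potential\<close>

text \<open>A partial injection of ADV's packets \<open>B\<close> into the algorithm's packets
  \<open>A\<close>, with \<open>None\<close> for unmatched. A partner must not expire before the
  packet matched to it.\<close>

definition deadline_matching :: "('p \<Rightarrow> nat) \<Rightarrow> 'p set \<Rightarrow> 'p set \<Rightarrow> ('p \<Rightarrow> 'p option) \<Rightarrow> bool" where
  "deadline_matching D A B \<phi> \<longleftrightarrow>
     (\<forall>b\<in>B. \<forall>a. \<phi> b = Some a \<longrightarrow> a \<in> A \<and> D b \<le> D a) \<and>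
     (\<forall>b\<in>B. \<forall>b'\<in>B. \<forall>a. \<phi> b = Some a \<longrightarrow> \<phi> b' = Some a \<longrightarrow> b = b')"

definition opt_weight :: "('p \<Rightarrow> real) \<Rightarrow> 'p option \<Rightarrow> real" where
  "opt_weight w x = (case x of None \<Rightarrow> 0 | Some a \<Rightarrow> w a)"

lemma opt_weight_simps [simp]: "opt_weight w None = 0" "opt_weight w (Some a) = w a"
  by (simp_all add: opt_weight_def)

definition shortfall :: "('p \<Rightarrow> real) \<Rightarrow> 'p set \<Rightarrow> ('p \<Rightarrow> 'p option) \<Rightarrow> real" where
  "shortfall w B \<phi> = (\<Sum>b\<in>B. max 0 (w b - opt_weight w (\<phi> b)))"

text \<open>
  Bounds how much more ADV, holding \<open>B\<close>, can earn in the future than if it held \<open>A\<close> instead.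
\<close>

definition potential :: "('p \<Rightarrow> real) \<Rightarrow> ('p \<Rightarrow> nat) \<Rightarrow> 'p set \<Rightarrow> 'p set \<Rightarrow> real" where
  "potential w D A B = Inf (shortfall w B ` Collect (deadline_matching D A B))"

lemma shortfall_nonneg: "0 \<le> shortfall w B \<phi>"
  by (auto simp: shortfall_def intro!: sum_nonneg)

lemma deadline_matching_None: "deadline_matching D A B (\<lambda>_. None)"
  by (simp add: deadline_matching_def)

lemma potential_le:
  assumes "deadline_matching D A B \<phi>"
  shows "potential w D A B \<le> shortfall w B \<phi>"
  unfolding potential_def
  by (rule cInf_lower) (use assms in \<open>auto intro!: bdd_belowI[of _ 0] simp: shortfall_nonneg\<close>)

lemma le_potential:
  assumes "\<And>\<phi>. deadline_matching D A B \<phi> \<Longrightarrow> c \<le> shortfall w B \<phi>"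
  shows "c \<le> potential w D A B"
  unfolding potential_def
  by (rule cInf_greatest) (use assms deadline_matching_None[of D A B] in auto)

lemma potential_nonneg: "0 \<le> potential w D A B"
  by (rule le_potential) (rule shortfall_nonneg)

text \<open>The identity matching costs nothing. This starts the amortization, where both buffers
  coincide.\<close>

lemma potential_self: "potential w D A A = 0"
proof (rule antisym)
  have "deadline_matching D A A Some" by (simp add: deadline_matching_def)
  from potential_le[OF this] show "potential w D A A \<le> 0" by (simp add: shortfall_def)
qed (rule potential_nonneg)

text \<open>Models the passage to the next time: the newly injected packets \<open>N\<close> are
  matched to themselves at no cost. A surviving packet of ADV keeps its partner, which survives too
  by the assumption on \<open>A'\<close>. Primed weights and deadlines belong to the extended
  instance and agree with the old ones on old packets.\<close>

lemma potential_advance_le: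
  assumes fin: "finite B"
    and B': "B' \<subseteq> B \<union> N" and N: "N \<subseteq> A'" "N \<inter> B = {}" "N \<inter> A = {}" "finite N"
    and A': "\<And>a b. a \<in> A \<Longrightarrow> b \<in> B \<inter> B' \<Longrightarrow> D b \<le> D a \<Longrightarrow> a \<in> A'"
    and agree: "\<And>x. x \<in> A \<union> B \<Longrightarrow> w' x = w x \<and> D' x = D x"
  shows "potential w' D' A' B' \<le> potential w D A B"
proof (rule le_potential)
  fix \<phi> assume m: "deadline_matching D A B \<phi>"
  define \<psi> where "\<psi> b = (if b \<in> N then Some b else \<phi> b)" for b
  have \<phi>A: "a \<in> A \<and> D b \<le> D a" if "b \<in> B" "\<phi> b = Some a" for a b
    using m that by (auto simp: deadline_matching_def)
  have inj: "b = b'" if "b \<in> B" "b' \<in> B" "\<phi> b = Some a" "\<phi> b' = Some a" for a b b'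
    using m that by (auto simp: deadline_matching_def)
  have "deadline_matching D' A' B' \<psi>"
    unfolding deadline_matching_def
  proof (intro conjI ballI allI impI)
    fix b a assume b: "b \<in> B'" "\<psi> b = Some a"
    have *: "b \<in> B \<and> a \<in> A \<and> D b \<le> D a \<and> D' b = D b \<and> D' a = D a" if "b \<notin> N"
      using b that B' \<phi>A[of b a] agree by (auto simp: \<psi>_def)
    show "a \<in> A'"
      using b N(1) A'[of a b] * by (cases "b \<in> N") (auto simp: \<psi>_def)
    show "D' b \<le> D' a"
      using b * by (cases "b \<in> N") (auto simp: \<psi>_def)
  next
    fix b b' a assume b: "b \<in> B'" "b' \<in> B'" "\<psi> b = Some a" "\<psi> b' = Some a"
    have *: "c \<in> B \<and> a \<in> A \<and> \<phi> c = Some a" if "c \<notin> N" "c \<in> B'" "\<psi> c = Some a" for c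
      using that B' \<phi>A[of c a] by (auto simp: \<psi>_def)
    have N': "c = a \<and> a \<notin> A" if "c \<in> N" "\<psi> c = Some a" for c
      using that N(3) by (auto simp: \<psi>_def)
    show "b = b'"
      using *[of b] *[of b'] N'[of b] N'[of b'] b inj[of b b' a] by blast
  qed
  then have "potential w' D' A' B' \<le> shortfall w' B' \<psi>" by (rule potential_le)
  also have "\<dots> = (\<Sum>b\<in>B' \<inter> B. max 0 (w' b - opt_weight w' (\<psi> b)))"
    unfolding shortfall_def using B' finite_subset[OF B'] fin N(4)
    by (intro sum.mono_neutral_right) (auto simp: \<psi>_def)
  also have "\<dots> = (\<Sum>b\<in>B' \<inter> B. max 0 (w b - opt_weight w (\<phi> b)))"
  proof (rule sum.cong)
    fix b assume b: "b \<in> B' \<inter> B"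
    then have "opt_weight w' (\<psi> b) = opt_weight w (\<phi> b)"
      using N \<phi>A agree by (cases "\<phi> b") (auto simp: \<psi>_def)
    then show "max 0 (w' b - opt_weight w' (\<psi> b)) = max 0 (w b - opt_weight w (\<phi> b))"
      using b agree by simp
  qed simp
  also have "\<dots> \<le> shortfall w B \<phi>"
    unfolding shortfall_def using fin by (intro sum_mono2) auto
  finally show "potential w' D' A' B' \<le> shortfall w B \<phi>" .
qed

text \<open>Triangle inequality: the packet matched to the removed \<open>f\<close> is rematched to
  the free packet in \<open>x\<close>, or left unmatched if \<open>x = None\<close>. On top of its
  old cost it pays at most the amount by which \<open>f\<close> exceeds \<open>x\<close>.\<close>

lemma shortfall_redirect:
  assumes m: "deadline_matching D A B \<phi>" and fin: "finite B" and f: "f \<in> A"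
    and x: "\<And>z. x = Some z \<Longrightarrow> z \<in> A \<and> z \<noteq> f \<and> D f \<le> D z \<and> (\<forall>b\<in>B. \<phi> b \<noteq> Some z)"
  shows "potential w D (A - {f}) B \<le> shortfall w B \<phi> + max 0 (w f - opt_weight w x)"
proof -
  define \<psi> where "\<psi> b = (if \<phi> b = Some f then x else \<phi> b)" for b
  have \<phi>A: "a \<in> A \<and> D b \<le> D a" if "b \<in> B" "\<phi> b = Some a" for a b
    using m that by (auto simp: deadline_matching_def)
  have inj: "b = b'" if "b \<in> B" "b' \<in> B" "\<phi> b = Some a" "\<phi> b' = Some a" for a b b'
    using m that by (auto simp: deadline_matching_def)
  have "deadline_matching D (A - {f}) B \<psi>"
    unfolding deadline_matching_def
  proof (intro conjI ballI allI impI)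
    fix b a assume b: "b \<in> B" "\<psi> b = Some a"
    show "a \<in> A - {f}"
      using b \<phi>A[of b] x[of a] by (auto simp: \<psi>_def split: if_splits)
    show "D b \<le> D a"
      using b \<phi>A[of b f] \<phi>A[of b a] x[of a] by (cases "\<phi> b = Some f") (auto simp: \<psi>_def)
  next
    fix b b' a assume "b \<in> B" "b' \<in> B" "\<psi> b = Some a" "\<psi> b' = Some a"
    then show "b = b'"
      using inj[of b b' a] inj[of b b' f] x[of a] by (auto simp: \<psi>_def split: if_splits)
  qed
  then have "potential w D (A - {f}) B \<le> shortfall w B \<psi>" by (rule potential_le)
  also have "\<dots> \<le> shortfall w B \<phi> + max 0 (w f - opt_weight w x)"
  proof (cases "\<exists>g\<in>B. \<phi> g = Some f")
    case True
    then obtain g where g: "g \<in> B" "\<phi> g = Some f" by blast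
    have "(\<Sum>b\<in>B - {g}. max 0 (w b - opt_weight w (\<psi> b))) = (\<Sum>b\<in>B - {g}. max 0 (w b - opt_weight w (\<phi> b)))"
      using inj g by (intro sum.cong) (auto simp: \<psi>_def)
    moreover have "max 0 (w g - opt_weight w (\<psi> g))
        \<le> max 0 (w g - opt_weight w (\<phi> g)) + max 0 (w f - opt_weight w x)"
      using g by (simp add: \<psi>_def)
    ultimately show ?thesis
      using sum.remove[OF fin g(1), of "\<lambda>b. max 0 (w b - opt_weight w (\<psi> b))"]
        sum.remove[OF fin g(1), of "\<lambda>b. max 0 (w b - opt_weight w (\<phi> b))"]
      by (simp add: shortfall_def)
  next
    case False
    then have "shortfall w B \<psi> = shortfall w B \<phi>"
      unfolding shortfall_def by (intro sum.cong) (auto simp: \<psi>_def)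
    then show ?thesis by simp
  qed
  finally show ?thesis .
qed

section \<open>Change of the potential by the transmissions of one step\<close>

lemma deadline_matching_mono:
  "deadline_matching D A B \<phi> \<Longrightarrow> B' \<subseteq> B \<Longrightarrow> deadline_matching D A B' \<phi>"
  unfolding deadline_matching_def by blast

lemma shortfall_remove:
  "finite B \<Longrightarrow> b \<in> B \<Longrightarrow>
    shortfall w B \<phi> = max 0 (w b - opt_weight w (\<phi> b)) + shortfall w (B - {b}) \<phi>"
  unfolding shortfall_def by (rule sum.remove)

text \<open>
  If ADV sends \<open>b\<close> matched to \<open>z\<close>, choose \<open>h k\<close> dominating \<open>z\<close>. When the algorithm sends \<open>h i\<close> with
  \<open>i \<ge> k\<close>, the packet matched to \<open>h i\<close> is redirected to \<open>z\<close>, whose deadline is late enough;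
  when \<open>i < k\<close>, it becomes unmatched, which costs at most \<open>w (h i)\<close>.
\<close>

lemma (in mix_chain) ex_charge:
  assumes m: "deadline_matching D A B \<phi>" and fin: "finite B"
    and D: "\<And>x. x \<in> A \<Longrightarrow> D x = d x + t"
    and y: "\<And>b. y = Some b \<Longrightarrow> b \<in> B"
  shows "\<exists>k\<in>{1..m}. \<forall>i\<in>{1..n}. opt_weight w y + potential w D (A - {h i}) (B - set_option y)
      \<le> shortfall w B \<phi> + (w (h k) + (if i < k then w (h i) else 0))"
proof -
  have hA: "h i \<in> A" "0 < w (h i)" if "i \<in> {1..n}" for i
    using that n_le h_in h_pos by auto
  \<comment> \<open>Here the packet matched to \<open>h i\<close> simply becomes unmatched.\<close>
  have drop: "potential w D (A - {h i}) B' \<le> shortfall w B' \<phi> + w (h i)"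
    if "B' \<subseteq> B" "i \<in> {1..n}" for B' i
    using shortfall_redirect[OF deadline_matching_mono[OF m that(1)] finite_subset[OF that(1) fin] hA(1)[OF that(2)],
        where x = None and w = w] hA(2)[OF that(2)] by simp
  consider "y = None" | b where "y = Some b" "\<phi> b = None" | b z where "y = Some b" "\<phi> b = Some z"
    by (metis option.exhaust)
  then show ?thesis
  proof cases
    \<comment> \<open>An idle ADV can be charged to \<open>k = 1\<close>: no index is below 1, and
      \<open>w (h 1)\<close> alone covers the loss of any \<open>h i\<close>.\<close>
    case 1
    have "w (h i) \<le> w (h 1)" if "i \<in> {1..n}" for i
      using weight_le_first that n_le by auto
    then show ?thesis
      using 1 drop[of B] n_pos n_le by (intro bexI[of _ 1]) force+
  next
    \<comment> \<open>The unmatched \<open>b\<close> is already paid in full by the shortfall, so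
      again \<open>k = 1\<close> covers the loss of \<open>h i\<close>.\<close>
    case 2
    have "w (h i) \<le> w (h 1)" if "i \<in> {1..n}" for i
      using weight_le_first that n_le by auto
    moreover have "shortfall w B \<phi> = max 0 (w b) + shortfall w (B - {b}) \<phi>"
      using shortfall_remove[OF fin y[OF 2(1)], of w \<phi>] 2 by simp
    ultimately show ?thesis
      using 2 drop[of "B - {b}"] n_pos n_le by (intro bexI[of _ 1]) force+
  next
    case 3
    let ?B = "B - {b}"
    have b: "b \<in> B" using y 3 by simp
    have z: "z \<in> A" using m b 3 by (auto simp: deadline_matching_def)
    have free: "\<phi> b' \<noteq> Some z" if "b' \<in> ?B" for b'
      using m b 3 that unfolding deadline_matching_def by blast
    have sf: "shortfall w B \<phi> = max 0 (w b - w z) + shortfall w ?B \<phi>"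
      using shortfall_remove[OF fin b, of w \<phi>] 3 by simp
    obtain k where k: "k \<in> {1..m}" "w z \<le> w (h k)" "d (h k) \<le> d z"
      using h_dominates[OF z] by (auto simp: dominated_def)
    have "w b + potential w D (A - {h i}) ?B \<le> shortfall w B \<phi> + (w (h k) + (if i < k then w (h i) else 0))"
      if i: "i \<in> {1..n}" for i
    proof (cases "i < k")
      case True
      then show ?thesis using drop[of ?B i] i k sf by auto
    next
      case False
      have dk: "d (h i) \<le> d (h k)" "w (h i) \<le> w (h k)"
        using h_deadline[of k i] h_weight[of k i] False i k n_le by (cases "i = k"; force)+
      show ?thesis
      proof (cases "h i = z")
        case True
        \<comment> \<open>The algorithm loses exactly the former partner of \<open>b\<close>, which
          no packet of \<open>?B\<close> uses.\<close>
        have "deadline_matching D (A - {h i}) ?B \<phi>"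
          using deadline_matching_mono[OF m, of ?B] free True unfolding deadline_matching_def by blast
        from potential_le[OF this, of w] show ?thesis using sf k False by simp
      next
        case neq: False
        \<comment> \<open>Redirection to the freed \<open>z\<close> is legal because
          \<open>d (h i) \<le> d (h k) \<le> d z\<close>. The credit suffices because
          \<open>w z\<close> and \<open>w (h i)\<close> are both at most
          \<open>w (h k)\<close>.\<close>
        have "potential w D (A - {h i}) ?B \<le> shortfall w ?B \<phi> + max 0 (w (h i) - opt_weight w (Some z))"
        proof (rule shortfall_redirect[OF deadline_matching_mono[OF m]])
          show "z' \<in> A \<and> z' \<noteq> h i \<and> D (h i) \<le> D z' \<and> (\<forall>b\<in>?B. \<phi> b \<noteq> Some z')" if "Some z = Some z'" for z'
            using that z neq free D[OF z] D[OF hA(1)[OF i]] dk k by auto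
        qed (use fin hA(1)[OF i] in auto)
        then show ?thesis using sf k dk False by (auto simp: max_def split: if_splits)
      qed
    qed
    then show ?thesis using 3 k by (intro bexI[of _ k]) auto
  qed
qed

text \<open>The index \<open>k\<close> from \<open>ex_charge\<close> is the same for all
  \<open>i\<close>, as ADV's choice \<open>y\<close> does not depend on the algorithm's; so
  averaging with \<open>p\<close> yields the sum in \<open>advantage_le_first\<close>. The shift by
  \<open>t\<close> relates the absolute deadlines \<open>D\<close> to the relative ones.\<close>

lemma (in mix_chain) potential_step:
  assumes fin: "finite B"
    and D: "\<And>x. x \<in> A \<Longrightarrow> D x = d x + t"
    and y: "\<And>b. y = Some b \<Longrightarrow> b \<in> B"
  shows "opt_weight w y + (\<Sum>i=1..n. p i * potential w D (A - {h i}) (B - set_option y))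
      \<le> potential w D A B + w (h 1)"
proof -
  let ?P = "\<lambda>i. potential w D (A - {h i}) (B - set_option y)"
  have "opt_weight w y + (\<Sum>i=1..n. p i * ?P i) - w (h 1) \<le> shortfall w B \<phi>"
    if m: "deadline_matching D A B \<phi>" for \<phi>
  proof -
    obtain k where k: "k \<in> {1..m}" and le: "\<And>i. i \<in> {1..n} \<Longrightarrow>
        opt_weight w y + ?P i \<le> shortfall w B \<phi> + (w (h k) + (if i < k then w (h i) else 0))"
      using ex_charge[OF m fin D y] by blast
    have "opt_weight w y + (\<Sum>i=1..n. p i * ?P i) = (\<Sum>i=1..n. p i * (opt_weight w y + ?P i))"
      using p_sum by (simp add: distrib_left sum.distrib flip: sum_distrib_right)
    also have "\<dots> \<le> (\<Sum>i=1..n. p i * (shortfall w B \<phi> + (w (h k) + (if i < k then w (h i) else 0))))"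
      using le p_nonneg by (intro sum_mono mult_left_mono) auto
    also have "\<dots> = shortfall w B \<phi> + (w (h k) + (\<Sum>i=1..n. p i * (if i < k then w (h i) else 0)))"
      using p_sum by (simp add: distrib_left sum.distrib flip: sum_distrib_right)
    also have "\<dots> \<le> shortfall w B \<phi> + w (h 1)"
      using advantage_le_first[OF k] by simp
    finally show ?thesis by simp
  qed
  from le_potential[OF this] show ?thesis by (simp add: algebra_simps)
qed

text \<open>Nothing can be matched into an empty buffer, so every packet of ADV is prepaid by its
  full weight.\<close>

lemma potential_step_empty:
  assumes fin: "finite B" and y: "\<And>b. y = Some b \<Longrightarrow> b \<in> B"
  shows "opt_weight w y + potential w D {} (B - set_option y) \<le> potential w D {} B"
proof (rule le_potential)
  fix \<phi> assume m: "deadline_matching D {} B \<phi>"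
  have pot: "potential w D {} (B - set_option y) \<le> shortfall w (B - set_option y) \<phi>"
    by (rule potential_le[OF deadline_matching_mono[OF m]]) auto
  show "opt_weight w y + potential w D {} (B - set_option y) \<le> shortfall w B \<phi>"
  proof (cases y)
    case (Some b)
    have "\<phi> b = None" using m y[OF Some] by (cases "\<phi> b") (auto simp: deadline_matching_def)
    then show ?thesis
      using shortfall_remove[OF fin y[OF Some], of w \<phi>] pot Some by simp
  qed (use pot in simp)
qed

section \<open>The law of the algorithm's history\<close>

primrec history_pmf :: "(history \<Rightarrow> packet option pmf) \<Rightarrow> nat \<Rightarrow> history pmf" where
  "history_pmf \<alpha> 0 = return_pmf []"
| "history_pmf \<alpha> (Suc t) = bind_pmf (history_pmf \<alpha> t) (\<lambda>xs. map_pmf (\<lambda>x. xs @ [x]) (\<alpha> xs))"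

lemma length_run_history [simp]: "length (run_history \<omega> t) = t"
  by (induction t) auto

lemma take_run_history: "i \<le> t \<Longrightarrow> take i (run_history \<omega> t) = run_history \<omega> i"
  by (induction t) (auto simp: le_Suc_eq)

lemma nth_run_history: "i < t \<Longrightarrow> run_history \<omega> t ! i = \<omega> (run_history \<omega> i)"
  by (induction t) (auto simp: less_Suc_eq nth_append)

text \<open>Turns the event of a given history into a condition on finitely many coordinates, those
  at its proper prefixes.\<close>

lemma run_history_eq_iff:
  "length xs = t \<Longrightarrow> run_history \<omega> t = xs \<longleftrightarrow> (\<forall>i<t. \<omega> (take i xs) = xs ! i)"
proof (induction t arbitrary: xs)
  case (Suc t)
  then obtain ys x where xs: "xs = ys @ [x]" "length ys = t"
    by (cases xs rule: rev_cases) auto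
  have "(\<forall>i<Suc t. \<omega> (take i xs) = xs ! i) \<longleftrightarrow> (\<forall>i<t. \<omega> (take i ys) = ys ! i) \<and> \<omega> ys = x"
    using xs by (auto simp: less_Suc_eq nth_append)
  then show ?case using Suc.IH[of ys] xs by auto
qed simp

lemma length_history_pmf: "xs \<in> set_pmf (history_pmf \<alpha> t) \<Longrightarrow> length xs = t"
  by (induction t arbitrary: xs) auto

lemma pmf_history_pmf:
  "length xs = t \<Longrightarrow> pmf (history_pmf \<alpha> t) xs = (\<Prod>i<t. pmf (\<alpha> (take i xs)) (xs ! i))"
proof (induction t arbitrary: xs)
  case (Suc t)
  then obtain ys x where xs: "xs = ys @ [x]" "length ys = t"
    by (cases xs rule: rev_cases) auto
  \<comment> \<open>The only way to reach \<open>xs\<close> is from \<open>ys\<close>, by the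
    decision \<open>x\<close>.\<close>
  have "pmf (map_pmf (\<lambda>x. zs @ [x]) (\<alpha> zs)) xs = indicator {ys} zs * pmf (\<alpha> ys) x" for zs
  proof (cases "zs = ys")
    case True
    then show ?thesis using xs pmf_map_inj'[of "\<lambda>x. ys @ [x]" "\<alpha> ys" x] by (simp add: inj_def)
  next
    case False
    then have "xs \<notin> set_pmf (map_pmf (\<lambda>x. zs @ [x]) (\<alpha> zs))" using xs by auto
    then have "pmf (map_pmf (\<lambda>x. zs @ [x]) (\<alpha> zs)) xs = 0" using pmf_eq_0_set_pmf by fast
    then show ?thesis using False by simp
  qed
  then have "pmf (history_pmf \<alpha> (Suc t)) xs
      = measure_pmf.expectation (history_pmf \<alpha> t) (\<lambda>zs. indicator {ys} zs * pmf (\<alpha> ys) x)"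
    by (simp add: pmf_bind)
  also have "\<dots> = pmf (history_pmf \<alpha> t) ys * pmf (\<alpha> ys) x"
    by (simp add: measure_pmf_single)
  also have "pmf (history_pmf \<alpha> t) ys = (\<Prod>i<t. pmf (\<alpha> (take i ys)) (ys ! i))"
    using Suc.IH xs by simp
  also have "\<dots> = (\<Prod>i<t. pmf (\<alpha> (take i xs)) (xs ! i))"
    using xs by (intro prod.cong) (auto simp: nth_append)
  also have "pmf (\<alpha> ys) x = pmf (\<alpha> (take t xs)) (xs ! t)"
    using xs by (simp add: nth_append)
  finally show ?case by simp
qed simp

text \<open>Independence of the decisions: a history of length \<open>t\<close> fixes one coordinate
  at each of its \<open>t\<close> proper prefixes, so its probability is a product. As histories are
  countable, single histories suffice for measurability and for the law.\<close>

lemma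
  fixes \<alpha> :: "history \<Rightarrow> packet option pmf"
  defines "P \<equiv> (\<Pi>\<^sub>M xs\<in>UNIV. measure_pmf (\<alpha> xs))"
  shows measurable_run_history: "(\<lambda>\<omega>. run_history \<omega> t) \<in> measurable P (count_space UNIV)"
    and distr_run_history:
      "distr P (count_space UNIV) (\<lambda>\<omega>. run_history \<omega> t) = measure_pmf (history_pmf \<alpha> t)"
proof -
  interpret product_prob_space "\<lambda>xs. measure_pmf (\<alpha> xs)" UNIV
    by unfold_locales
  have space: "space P = UNIV" by (auto simp: P_def space_PiM)
  have cyl: "{\<omega>. run_history \<omega> t = xs} \<in> sets P
      \<and> emeasure P {\<omega>. run_history \<omega> t = xs} = ennreal (pmf (history_pmf \<alpha> t) xs)" for xs
  proof (cases "length xs = t")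
    case True
    define J where "J = (\<lambda>i. take i xs) ` {..<t}"
    have eq: "{\<omega>. run_history \<omega> t = xs} = {\<omega>\<in>space P. \<forall>ys\<in>J. \<omega> ys \<in> {xs ! length ys}}"
      using True by (auto simp: space run_history_eq_iff J_def)
    \<comment> \<open>Prefixes of different lengths are different coordinates, so none is counted
      twice.\<close>
    have inj: "inj_on (\<lambda>i. take i xs) {..<t}"
      using True by (auto intro!: inj_on_inverseI[of _ length])
    have "emeasure P {\<omega>\<in>space P. \<forall>ys\<in>J. \<omega> ys \<in> {xs ! length ys}}
        = (\<Prod>ys\<in>J. emeasure (measure_pmf (\<alpha> ys)) {xs ! length ys})"
      unfolding P_def by (rule emeasure_PiM_Collect) (auto simp: J_def)
    also have "\<dots> = (\<Prod>i<t. ennreal (pmf (\<alpha> (take i xs)) (xs ! i)))"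
      unfolding J_def using True inj
      by (subst prod.reindex) (auto simp: emeasure_pmf_single intro!: prod.cong)
    also have "\<dots> = ennreal (pmf (history_pmf \<alpha> t) xs)"
      by (simp add: pmf_history_pmf[OF True] prod_ennreal)
    finally have "emeasure P {\<omega>. run_history \<omega> t = xs} = ennreal (pmf (history_pmf \<alpha> t) xs)"
      by (simp only: eq)
    moreover have "{\<omega>\<in>space P. \<forall>ys\<in>J. \<omega> ys \<in> {xs ! length ys}} \<in> sets P"
      unfolding P_def J_def by measurable
    ultimately show ?thesis by (simp only: eq)
  next
    case False
    then have "{\<omega>. run_history \<omega> t = xs} = {}" by auto
    moreover have "pmf (history_pmf \<alpha> t) xs = 0"
      using False length_history_pmf[of xs \<alpha> t] by (auto simp: pmf_eq_0_set_pmf)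
    ultimately show ?thesis by simp
  qed
  have vimage: "(\<lambda>\<omega>. run_history \<omega> t) -` {xs} \<inter> space P = {\<omega>. run_history \<omega> t = xs}" for xs
    by (auto simp: space)
  show meas: "(\<lambda>\<omega>. run_history \<omega> t) \<in> measurable P (count_space UNIV)"
    using cyl by (subst measurable_count_space_eq2_countable) (auto simp: vimage)
  show "distr P (count_space UNIV) (\<lambda>\<omega>. run_history \<omega> t) = measure_pmf (history_pmf \<alpha> t)"
  proof (rule measure_eqI_countable[of _ UNIV])
    fix xs
    show "emeasure (distr P (count_space UNIV) (\<lambda>\<omega>. run_history \<omega> t)) {xs}
        = emeasure (measure_pmf (history_pmf \<alpha> t)) {xs}"
      using cyl[of xs] by (simp add: emeasure_distr[OF meas] vimage emeasure_pmf_single)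
  qed auto
qed

lemma nn_integral_run_history:
  "(\<integral>\<^sup>+\<omega>. f (run_history \<omega> t) \<partial>(\<Pi>\<^sub>M xs\<in>UNIV. measure_pmf (\<alpha> xs)))
     = (\<integral>\<^sup>+xs. f xs \<partial>measure_pmf (history_pmf \<alpha> t))"
  unfolding distr_run_history[symmetric]
  by (subst nn_integral_distr[OF measurable_run_history]) auto

text \<open>An event that holds almost surely meets every event of positive probability. This makes
  facts about almost all runs available at each history in the support.\<close>

lemma AE_run_history_ex:
  assumes "AE \<omega> in (\<Pi>\<^sub>M xs\<in>UNIV. measure_pmf (\<alpha> xs)). Q \<omega>"
    and "xs \<in> set_pmf (history_pmf \<alpha> t)"
  shows "\<exists>\<omega>. Q \<omega> \<and> run_history \<omega> t = xs"
proof -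
  let ?S = "{xs. \<exists>\<omega>. Q \<omega> \<and> run_history \<omega> t = xs}"
  have "AE \<omega> in (\<Pi>\<^sub>M xs\<in>UNIV. measure_pmf (\<alpha> xs)). run_history \<omega> t \<in> ?S"
    using assms(1) by (rule AE_mp) (auto intro!: AE_I2)
  then have "AE xs in distr (\<Pi>\<^sub>M xs\<in>UNIV. measure_pmf (\<alpha> xs)) (count_space UNIV) (\<lambda>\<omega>. run_history \<omega> t).
      xs \<in> ?S"
    by (subst AE_distr_iff[OF measurable_run_history]) auto
  then show ?thesis
    using assms(2) unfolding distr_run_history by (auto simp: AE_measure_pmf_iff)
qed

text \<open>There are only countably many histories, so the null sets of the single coordinates can
  be joined.\<close>

lemma AE_decisions_in_support:
  fixes \<alpha> :: "history \<Rightarrow> packet option pmf"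
  shows "AE \<omega> in (\<Pi>\<^sub>M xs\<in>UNIV. measure_pmf (\<alpha> xs)). \<forall>xs. \<omega> xs \<in> set_pmf (\<alpha> xs)"
proof (subst AE_all_countable, intro allI)
  fix xs
  show "AE \<omega> in (\<Pi>\<^sub>M xs\<in>UNIV. measure_pmf (\<alpha> xs)). \<omega> xs \<in> set_pmf (\<alpha> xs)"
    by (rule AE_PiM_component) (auto simp: AE_measure_pmf prob_space_measure_pmf)
qed

section \<open>Running MIX-R against an adaptive adversary\<close>

lemma pending_cong:
  assumes "\<And>i. i \<le> length xs \<Longrightarrow> I i = I' i"
  shows "pending I xs = pending I' xs"
  using assms by (auto simp: pending_def lifespan_def)

lemma finite_pending: "finite (pending I xs)"
proof (rule finite_subset)
  show "pending I xs \<subseteq> Sigma {..length xs} (\<lambda>t. {..<length (I t)})"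
    by (auto simp: pending_def)
qed auto

text \<open>Absolute expiry time, which stays fixed as time passes, so that matchings persist from
  step to step.\<close>

definition deadline :: "inst \<Rightarrow> packet \<Rightarrow> nat" where
  "deadline I p = fst p + lifespan I p"

lemma pending_nth:
  assumes "x \<in> pending I xs"
  shows "(weight I x, lifespan I x) \<in> set (I (fst x))" and "fst x \<le> length xs"
  using assms by (auto simp: pending_def weight_def lifespan_def)

lemma rel_deadline_pending:
  "x \<in> pending I xs \<Longrightarrow> deadline I x = rel_deadline I (length xs) x + length xs"
  "x \<in> pending I xs \<Longrightarrow> 0 < rel_deadline I (length xs) x"
  "x \<in> pending I xs \<Longrightarrow> rel_deadline I (length xs) x \<le> lifespan I x"
  by (auto simp: pending_def rel_deadline_def deadline_def)

text \<open>The common consequence of the two restrictions on instances, through which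
  \<open>s\<close> enters the ratio: MIX-R never chooses among more than \<open>s\<close>
  packets.\<close>

definition few_nondominated :: "nat \<Rightarrow> inst \<Rightarrow> bool" where
  "few_nondominated s I \<longleftrightarrow>
     (\<forall>xs m n h p. mix_chain (weight I) (rel_deadline I (length xs)) (pending I xs) m n h p \<longrightarrow> n \<le> s)"

lemma bounded_inst_few_nondominated:
  assumes "bounded_inst s I"
  shows "few_nondominated s I"
  unfolding few_nondominated_def
proof (intro allI impI)
  fix xs m n h p
  assume "mix_chain (weight I) (rel_deadline I (length xs)) (pending I xs) m n h p"
  then interpret mix_chain "weight I" "rel_deadline I (length xs)" "pending I xs" m n h p .
  show "n \<le> s"
  proof (rule n_le_deadlines)
    fix x assume x: "x \<in> pending I xs"
    have "lifespan I x \<le> s"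
      using assms pending_nth(1)[OF x] by (force simp: bounded_inst_def)
    then show "0 < rel_deadline I (length xs) x \<and> rel_deadline I (length xs) x \<le> s"
      using rel_deadline_pending(2,3)[OF x] by simp
  qed
qed

lemma few_weights_few_nondominated:
  assumes "few_weights s I"
  shows "few_nondominated s I"
  unfolding few_nondominated_def
proof (intro allI impI)
  fix xs m n h p
  assume "mix_chain (weight I) (rel_deadline I (length xs)) (pending I xs) m n h p"
  then interpret mix_chain "weight I" "rel_deadline I (length xs)" "pending I xs" m n h p .
  show "n \<le> s"
  proof (rule n_le_weights)
    show "weight I ` pending I xs \<subseteq> (\<Union>t. fst ` set (I t))"
      using pending_nth(1)[of _ I xs] by force
  qed (use assms in \<open>auto simp: few_weights_def\<close>)
qed

lemma mix_r_pending:
  assumes "tie_breaking tie" and "\<And>x. x \<in> pending I xs \<Longrightarrow> 0 < weight I x"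
    and "Some x \<in> set_pmf (mix_r tie I xs)"
  shows "x \<in> pending I xs"
proof (cases "pending I xs = {}")
  case False
  have pick: "\<And>B. B \<noteq> {} \<Longrightarrow> tie I xs B \<in> B"
    using assms(1) by (simp add: tie_breaking_def)
  obtain m n h p where c: "mix_chain (weight I) (rel_deadline I (length xs)) (pending I xs) m n h p"
    and step: "mix_r_step (tie I xs) (weight I) (rel_deadline I (length xs)) (pending I xs)
      = pmf_of_list (map (\<lambda>k. (h k, p k)) [1..<n + 1])"
    by (rule mix_r_step_chain[where d = "rel_deadline I (length xs)", OF pick finite_pending False assms(2)])
  interpret mix_chain "weight I" "rel_deadline I (length xs)" "pending I xs" m n h p by (rule c)
  have "x \<in> h ` {1..n}"
    using assms(3) False set_pmf_chain unfolding mix_r_def step by (auto simp del: upt_Suc)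
  then show ?thesis using h_in n_le by auto
qed (use assms(3) in \<open>simp add: mix_r_def\<close>)

text \<open>\<open>potential_step\<close> bounds ADV's amortized gain by the weight of
  \<open>h 1\<close>, and by \<open>expected_weight_ge\<close> MIX-R earns at least \<open>c\<close>
  times that. Potentials are added on both sides because subtraction of extended nonnegative reals
  truncates.\<close>

lemma mix_r_amortized:
  assumes tie: "tie_breaking tie" and pos: "\<And>x. x \<in> pending I xs \<Longrightarrow> 0 < weight I x"
    and few: "few_nondominated s I" and s: "1 \<le> s"
    and fin: "finite B" and y: "\<And>b. y = Some b \<Longrightarrow> b \<in> B" and y0: "0 \<le> opt_weight (weight I) y"
  defines "c \<equiv> 1 - (1 - 1 / real s) ^ s"
  defines "\<Phi> \<equiv> potential (weight I) (deadline I)"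
  shows "ennreal c * (ennreal (opt_weight (weight I) y)
        + (\<integral>\<^sup>+x. ennreal (\<Phi> (pending I xs - set_option x) (B - set_option y)) \<partial>measure_pmf (mix_r tie I xs)))
      \<le> ennreal c * ennreal (\<Phi> (pending I xs) B)
        + (\<integral>\<^sup>+x. ennreal (opt_weight (weight I) x) \<partial>measure_pmf (mix_r tie I xs))"
proof (cases "pending I xs = {}")
  case True
  have "ennreal (opt_weight (weight I) y) + ennreal (\<Phi> {} (B - set_option y))
      = ennreal (opt_weight (weight I) y + \<Phi> {} (B - set_option y))"
    using y0 by (intro ennreal_plus[symmetric]) (auto simp: \<Phi>_def potential_nonneg)
  also have "\<dots> \<le> ennreal (\<Phi> {} B)"
    unfolding \<Phi>_def using potential_step_empty[OF fin y] by (intro ennreal_leI) auto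
  finally show ?thesis
    using True by (simp add: mix_r_def mult_left_mono)
next
  case False
  let ?A = "pending I xs"
  have pick: "\<And>B. B \<noteq> {} \<Longrightarrow> tie I xs B \<in> B"
    using tie by (simp add: tie_breaking_def)
  obtain m n h p where ch: "mix_chain (weight I) (rel_deadline I (length xs)) ?A m n h p"
    and step: "mix_r_step (tie I xs) (weight I) (rel_deadline I (length xs)) ?A
      = pmf_of_list (map (\<lambda>k. (h k, p k)) [1..<n + 1])"
    by (rule mix_r_step_chain[where d = "rel_deadline I (length xs)", OF pick finite_pending False pos])
  interpret mix_chain "weight I" "rel_deadline I (length xs)" ?A m n h p by (rule ch)
  have int: "(\<integral>\<^sup>+x. ennreal (f x) \<partial>measure_pmf (mix_r tie I xs)) = ennreal (\<Sum>i=1..n. p i * f (Some (h i)))"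
    if "\<And>i. i \<in> {1..n} \<Longrightarrow> 0 \<le> f (Some (h i))" for f
  proof -
    have "(\<integral>\<^sup>+x. ennreal (f x) \<partial>measure_pmf (mix_r tie I xs))
        = (\<integral>\<^sup>+x. ennreal (f (Some x)) \<partial>measure_pmf (pmf_of_list (map (\<lambda>k. (h k, p k)) [1..<n + 1])))"
      using False unfolding mix_r_def step by (simp del: upt_Suc)
    also have "\<dots> = (\<Sum>i=1..n. ennreal (p i) * ennreal (f (Some (h i))))"
      by (rule nn_integral_chain)
    also have "\<dots> = (\<Sum>i=1..n. ennreal (p i * f (Some (h i))))"
      using that p_nonneg by (intro sum.cong) (auto simp: ennreal_mult)
    also have "\<dots> = ennreal (\<Sum>i=1..n. p i * f (Some (h i)))"
      using that p_nonneg by (intro sum_ennreal) auto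
    finally show ?thesis .
  qed
  have c: "0 \<le> c"
    unfolding c_def using s by (simp add: power_le_one)
  have n: "n \<le> s" using few ch unfolding few_nondominated_def by blast
  have w0: "0 \<le> weight I (h i)" if "i \<in> {1..n}" for i
    using h_pos[of i] that n_le by auto
  have "opt_weight (weight I) y + (\<Sum>i=1..n. p i * \<Phi> (?A - {h i}) (B - set_option y)) \<le> \<Phi> ?A B + weight I (h 1)"
    unfolding \<Phi>_def
    by (rule potential_step[where t = "length xs"]) (use fin y rel_deadline_pending(1) in auto)
  then have "c * (opt_weight (weight I) y + (\<Sum>i=1..n. p i * \<Phi> (?A - {h i}) (B - set_option y)))
      \<le> c * (\<Phi> ?A B + weight I (h 1))"
    using c by (rule mult_left_mono)
  also have "\<dots> \<le> c * \<Phi> ?A B + (\<Sum>i=1..n. p i * weight I (h i))"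
    using expected_weight_ge[OF n] by (simp add: c_def distrib_left)
  finally have main: "c * (opt_weight (weight I) y + (\<Sum>i=1..n. p i * \<Phi> (?A - {h i}) (B - set_option y)))
      \<le> c * \<Phi> ?A B + (\<Sum>i=1..n. p i * weight I (h i))" .
  have \<Phi>0: "0 \<le> \<Phi> A' B'" for A' B' by (simp add: \<Phi>_def potential_nonneg)
  have S0: "0 \<le> (\<Sum>i=1..n. p i * \<Phi> (?A - {h i}) (B - set_option y))" "0 \<le> (\<Sum>i=1..n. p i * weight I (h i))"
    using p_nonneg \<Phi>0 w0 by (auto intro!: sum_nonneg)
  have "ennreal c * (ennreal (opt_weight (weight I) y)
        + (\<integral>\<^sup>+x. ennreal (\<Phi> (?A - set_option x) (B - set_option y)) \<partial>measure_pmf (mix_r tie I xs)))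
      = ennreal (c * (opt_weight (weight I) y + (\<Sum>i=1..n. p i * \<Phi> (?A - {h i}) (B - set_option y))))"
    using c y0 S0 by (subst int) (auto simp: \<Phi>0 ennreal_mult)
  also have "\<dots> \<le> ennreal (c * \<Phi> ?A B + (\<Sum>i=1..n. p i * weight I (h i)))"
    using main by (rule ennreal_leI)
  also have "\<dots> = ennreal c * ennreal (\<Phi> ?A B)
        + (\<integral>\<^sup>+x. ennreal (opt_weight (weight I) x) \<partial>measure_pmf (mix_r tie I xs))"
    using c S0 w0 by (subst int) (auto simp: \<Phi>0 ennreal_mult)
  finally show ?thesis .
qed

section \<open>Expected gains over the whole run\<close>

lemma revealed_run_history:
  "revealed inject (run_history \<omega> t) i = (if i \<le> t then run_inst inject \<omega> i else [])"
  by (simp add: revealed_def run_inst_def take_run_history)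

lemma revealed_append:
  "i \<le> length xs \<Longrightarrow> revealed inject (xs @ [x]) i = revealed inject xs i"
  by (simp add: revealed_def)

lemma bounded_inst_revealed:
  "bounded_inst s (run_inst inject \<omega>) \<Longrightarrow> bounded_inst s (revealed inject (run_history \<omega> t))"
  by (fastforce simp: bounded_inst_def revealed_run_history)

lemma few_weights_revealed:
  assumes "few_weights s (run_inst inject \<omega>)"
  shows "few_weights s (revealed inject (run_history \<omega> t))"
proof -
  let ?W = "\<lambda>I. \<Union>t. fst ` set (I t :: (real \<times> nat) list)"
  have "?W (revealed inject (run_history \<omega> t)) \<subseteq> ?W (run_inst inject \<omega>)"
    by (auto simp: revealed_run_history split: if_splits)
  moreover have "finite (?W (run_inst inject \<omega>))" "card (?W (run_inst inject \<omega>)) \<le> s"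
    using assms by (auto simp: few_weights_def)
  ultimately show ?thesis
    unfolding few_weights_def by (meson card_mono finite_subset le_trans)
qed

lemma gain_eq: "gain I x = (\<Sum>t. ennreal (opt_weight (weight I) (x t)))"
  unfolding gain_def by (intro suminf_cong) (auto split: option.split)

text \<open>The class of instances is replaced by \<open>few_nondominated\<close> on the revealed
  instances, because these are what each step of the algorithm is computed from.\<close>

locale adaptive_run =
  fixes s :: nat and tie :: tie_rule
    and inject :: "history \<Rightarrow> (real \<times> nat) list" and adv :: "history \<Rightarrow> packet option"
  assumes s: "1 \<le> s" and tie: "tie_breaking tie"
    and AE_admissible: "AE \<omega> in run_space (mix_r tie) inject.
      valid_inst (run_inst inject \<omega>) \<and> feasible (run_inst inject \<omega>) (adv_schedule adv \<omega>) \<and>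
      (\<forall>t. few_nondominated s (revealed inject (run_history \<omega> t)))"
begin

abbreviation \<alpha> :: "history \<Rightarrow> packet option pmf" where
  "\<alpha> xs \<equiv> mix_r tie (revealed inject xs) xs"

text \<open>ADV is deterministic, so its past is a function of the algorithm's history; hence so is
  the potential.\<close>

definition adv_history :: "history \<Rightarrow> history" where
  "adv_history xs = map (\<lambda>i. adv (take i xs)) [0..<length xs]"

definition \<Phi> :: "history \<Rightarrow> real" where
  "\<Phi> xs = potential (weight (revealed inject xs)) (deadline (revealed inject xs))
     (pending (revealed inject xs) xs) (pending (revealed inject xs) (adv_history xs))"

definition adv_gain :: "history \<Rightarrow> ennreal" where
  "adv_gain xs = ennreal (opt_weight (weight (revealed inject xs)) (adv xs))"

text \<open>The gain of step \<open>t\<close>, read off a history of length \<open>Suc t\<close>;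
  \<open>butlast\<close> restores the instance known when the last packet was sent.\<close>

definition last_gain :: "history \<Rightarrow> ennreal" where
  "last_gain ys = ennreal (opt_weight (weight (revealed inject (butlast ys))) (last ys))"

definition good :: "(history \<Rightarrow> packet option) \<Rightarrow> bool" where
  "good \<omega> \<longleftrightarrow> valid_inst (run_inst inject \<omega>) \<and> feasible (run_inst inject \<omega>) (adv_schedule adv \<omega>) \<and>
     (\<forall>t. few_nondominated s (revealed inject (run_history \<omega> t))) \<and> (\<forall>xs. \<omega> xs \<in> set_pmf (\<alpha> xs))"

lemma AE_good: "AE \<omega> in run_space (mix_r tie) inject. good \<omega>"
  using AE_admissible AE_decisions_in_support[of \<alpha>, folded run_space_def]
  by eventually_elim (simp add: good_def)

lemma length_adv_history [simp]: "length (adv_history xs) = length xs"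
  by (simp add: adv_history_def)

lemma adv_history_append: "adv_history (xs @ [x]) = adv_history xs @ [adv xs]"
  by (auto simp: adv_history_def)

lemma weight_pos:
  assumes "good \<omega>" "x \<in> pending (revealed inject (run_history \<omega> t)) ys"
  shows "0 < weight (revealed inject (run_history \<omega> t)) x"
proof -
  have "(weight (revealed inject (run_history \<omega> t)) x, lifespan (revealed inject (run_history \<omega> t)) x)
      \<in> set (run_inst inject \<omega> (fst x))"
    using pending_nth(1)[OF assms(2)] by (simp add: revealed_run_history split: if_splits)
  then show ?thesis
    using assms(1) by (auto simp: good_def valid_inst_def)
qed

lemma adv_pending:
  assumes "good \<omega>" "adv (run_history \<omega> t) = Some b"
  shows "b \<in> pending (revealed inject (run_history \<omega> t)) (adv_history (run_history \<omega> t))"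
proof -
  have hist: "map (adv_schedule adv \<omega>) [0..<t] = adv_history (run_history \<omega> t)"
    by (auto simp: adv_history_def adv_schedule_def take_run_history)
  have "adv_schedule adv \<omega> t = Some b"
    using assms(2) by (simp add: adv_schedule_def)
  then have "b \<in> pending (run_inst inject \<omega>) (map (adv_schedule adv \<omega>) [0..<t])"
    using assms(1) unfolding good_def feasible_def by blast
  also have "\<dots> = pending (revealed inject (run_history \<omega> t)) (adv_history (run_history \<omega> t))"
    unfolding hist by (rule pending_cong) (simp add: revealed_run_history)
  finally show ?thesis .
qed

lemma alg_pending:
  assumes "good \<omega>" "Some p \<in> set_pmf (\<alpha> (run_history \<omega> t))"
  shows "p \<in> pending (revealed inject (run_history \<omega> t)) (run_history \<omega> t)"
  using mix_r_pending[OF tie _ assms(2)] weight_pos[OF assms(1)] by blast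

lemma transmitted_earlier:
  assumes "good \<omega>" "Some p \<in> set (run_history \<omega> t)"
  shows "fst p < t"
proof -
  obtain i where i: "i < t" "run_history \<omega> t ! i = Some p"
    using assms(2) by (auto simp: in_set_conv_nth)
  then have "Some p \<in> set_pmf (\<alpha> (run_history \<omega> i))"
    using assms(1) nth_run_history[of i t \<omega>] unfolding good_def by metis
  from pending_nth(2)[OF alg_pending[OF assms(1) this]] i show ?thesis by simp
qed

text \<open>The right-hand side is the potential just after both transmissions; by
  \<open>potential_advance_le\<close>, expiry and injection do not raise it.\<close>

lemma \<Phi>_append_le:
  assumes "good \<omega>" and xs: "xs = run_history \<omega> t" and x: "x \<in> set_pmf (\<alpha> xs)"
  shows "\<Phi> (xs @ [x]) \<le> potential (weight (revealed inject xs)) (deadline (revealed inject xs))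
     (pending (revealed inject xs) xs - set_option x)
     (pending (revealed inject xs) (adv_history xs) - set_option (adv xs))"
proof -
  let ?I = "revealed inject xs" and ?I' = "revealed inject (xs @ [x])"
  \<comment> \<open>The packets injected at the next time; positive lifespan is what
    \<open>pending\<close> demands of them at release.\<close>
  define N where "N = {p. fst p = Suc t \<and> snd p < length (?I' (Suc t)) \<and> 0 < lifespan ?I' p}"
  have len: "length xs = t" by (simp add: xs)
  have agree: "weight ?I' p = weight ?I p \<and> lifespan ?I' p = lifespan ?I p \<and> ?I' (fst p) = ?I (fst p)"
    if "fst p \<le> t" for p
    using that revealed_append[of "fst p" xs inject x] len by (simp add: weight_def lifespan_def)
  have past: "fst p \<le> t" if "Some p \<in> set (xs @ [x])" for p
    using that transmitted_earlier[OF assms(1), of p t] alg_pending[OF assms(1), of p t] pending_nth(2)[of p ?I xs]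
      x xs len by auto
  have finN: "finite N"
    by (rule finite_subset[of _ "{Suc t} \<times> {..<length (?I' (Suc t))}"]) (auto simp: N_def)
  show ?thesis
    unfolding \<Phi>_def adv_history_append
  proof (rule potential_advance_le[where N = N])
    show "finite (pending ?I (adv_history xs) - set_option (adv xs))"
      by (simp add: finite_pending)
    show "pending ?I' (adv_history xs @ [adv xs]) \<subseteq> pending ?I (adv_history xs) - set_option (adv xs) \<union> N"
    proof
      fix p assume p: "p \<in> pending ?I' (adv_history xs @ [adv xs])"
      show "p \<in> pending ?I (adv_history xs) - set_option (adv xs) \<union> N"
      proof (cases "fst p \<le> t")
        case True
        then show ?thesis using p agree[OF True] len by (auto simp: pending_def)
      next
        case False
        then have "fst p = Suc t" using p len by (auto simp: pending_def)
        then show ?thesis using p len by (auto simp: pending_def N_def)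
      qed
    qed
    show "N \<subseteq> pending ?I' (xs @ [x])"
      using past len by (fastforce simp: N_def pending_def)
    show "N \<inter> (pending ?I (adv_history xs) - set_option (adv xs)) = {}"
      using len by (auto simp: N_def pending_def)
    show "N \<inter> (pending ?I xs - set_option x) = {}"
      using len by (auto simp: N_def pending_def)
    show "a \<in> pending ?I' (xs @ [x])"
      if a: "a \<in> pending ?I xs - set_option x"
        and b: "b \<in> (pending ?I (adv_history xs) - set_option (adv xs)) \<inter> pending ?I' (adv_history xs @ [adv xs])"
        and le: "deadline ?I b \<le> deadline ?I a" for a b
    proof -
      \<comment> \<open>\<open>b\<close> is alive at time \<open>Suc t\<close>, and its partner
        \<open>a\<close> expires no earlier, so \<open>a\<close> is alive too.\<close>
      have "fst b \<le> t" using b len by (auto simp: pending_def)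
      then have "Suc t < deadline ?I b"
        using b agree len by (auto simp: pending_def deadline_def)
      moreover have "fst a \<le> t" using a len by (auto simp: pending_def)
      ultimately show ?thesis
        using a le agree[of a] len by (auto simp: pending_def deadline_def)
    qed
    show "weight ?I' p = weight ?I p \<and> deadline ?I' p = deadline ?I p"
      if "p \<in> pending ?I xs - set_option x \<union> (pending ?I (adv_history xs) - set_option (adv xs))" for p
      using that agree[of p] len by (auto simp: pending_def deadline_def)
  qed (rule finN)
qed

abbreviation c :: real where
  "c \<equiv> 1 - (1 - 1 / real s) ^ s"

text \<open>\<open>mix_r_amortized\<close> handles the transmissions and
  \<open>\<Phi>_append_le\<close> the rest of the step. Since \<open>xs\<close> has positive
  probability, some good run passes through it and supplies their hypotheses.\<close>

lemma amortized_step: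
  assumes "xs \<in> set_pmf (history_pmf \<alpha> t)"
  shows "ennreal c * (adv_gain xs + (\<integral>\<^sup>+x. ennreal (\<Phi> (xs @ [x])) \<partial>measure_pmf (\<alpha> xs)))
      \<le> ennreal c * ennreal (\<Phi> xs) + (\<integral>\<^sup>+x. last_gain (xs @ [x]) \<partial>measure_pmf (\<alpha> xs))"
proof -
  obtain \<omega> where \<omega>: "good \<omega>" "run_history \<omega> t = xs"
    using AE_run_history_ex[OF AE_good[unfolded run_space_def] assms] by blast
  let ?I = "revealed inject xs"
  have adv_in: "b \<in> pending ?I (adv_history xs)" if "adv xs = Some b" for b
    using adv_pending[OF \<omega>(1), of t b] that \<omega>(2) by simp
  have adv_nonneg: "0 \<le> opt_weight (weight ?I) (adv xs)"
    using weight_pos[OF \<omega>(1), of _ t, unfolded \<omega>(2)] adv_in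
    by (cases "adv xs") (auto intro: less_imp_le)
  have "(\<integral>\<^sup>+x. ennreal (\<Phi> (xs @ [x])) \<partial>measure_pmf (\<alpha> xs))
      \<le> (\<integral>\<^sup>+x. ennreal (potential (weight ?I) (deadline ?I) (pending ?I xs - set_option x)
            (pending ?I (adv_history xs) - set_option (adv xs))) \<partial>measure_pmf (\<alpha> xs))"
    by (intro nn_integral_mono_AE)
       (auto simp: AE_measure_pmf_iff intro!: ennreal_leI \<Phi>_append_le[OF \<omega>(1) \<omega>(2)[symmetric]])
  then have "ennreal c * (adv_gain xs + (\<integral>\<^sup>+x. ennreal (\<Phi> (xs @ [x])) \<partial>measure_pmf (\<alpha> xs)))
      \<le> ennreal c * (adv_gain xs
        + (\<integral>\<^sup>+x. ennreal (potential (weight ?I) (deadline ?I) (pending ?I xs - set_option x)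
            (pending ?I (adv_history xs) - set_option (adv xs))) \<partial>measure_pmf (\<alpha> xs)))"
    by (intro mult_left_mono add_left_mono) auto
  also have "\<dots> \<le> ennreal c * ennreal (\<Phi> xs)
        + (\<integral>\<^sup>+x. ennreal (opt_weight (weight ?I) x) \<partial>measure_pmf (\<alpha> xs))"
    unfolding adv_gain_def \<Phi>_def
  proof (rule mix_r_amortized[OF tie _ _ s finite_pending])
    show "0 < weight ?I x" if "x \<in> pending ?I xs" for x
      using weight_pos[OF \<omega>(1), of x t] that \<omega>(2) by simp
    show "few_nondominated s ?I"
      using \<omega> by (auto simp: good_def)
  qed (use adv_in adv_nonneg in auto)
  finally show ?thesis by (simp add: last_gain_def)
qed

lemma nn_integral_history_pmf_Suc:
  "(\<integral>\<^sup>+ys. f ys \<partial>measure_pmf (history_pmf \<alpha> (Suc t)))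
     = (\<integral>\<^sup>+xs. (\<integral>\<^sup>+x. f (xs @ [x]) \<partial>measure_pmf (\<alpha> xs)) \<partial>measure_pmf (history_pmf \<alpha> t))"
  by simp

text \<open>Summing the amortized steps telescopes the potential, which starts at 0.\<close>

lemma amortized_sum:
  "ennreal c * ((\<Sum>t<T. \<integral>\<^sup>+xs. adv_gain xs \<partial>measure_pmf (history_pmf \<alpha> t))
       + (\<integral>\<^sup>+xs. ennreal (\<Phi> xs) \<partial>measure_pmf (history_pmf \<alpha> T)))
     \<le> (\<Sum>t<T. \<integral>\<^sup>+xs. last_gain xs \<partial>measure_pmf (history_pmf \<alpha> (Suc t)))"
proof (induction T)
  case 0
  show ?case by (simp add: \<Phi>_def adv_history_def potential_self)
next
  case (Suc T)
  let ?a = "\<lambda>t. \<integral>\<^sup>+xs. adv_gain xs \<partial>measure_pmf (history_pmf \<alpha> t)"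
  let ?u = "\<lambda>t. \<integral>\<^sup>+xs. ennreal (\<Phi> xs) \<partial>measure_pmf (history_pmf \<alpha> t)"
  let ?b = "\<lambda>t. \<integral>\<^sup>+xs. last_gain xs \<partial>measure_pmf (history_pmf \<alpha> (Suc t))"
  have "ennreal c * (?a T + ?u (Suc T))
      = (\<integral>\<^sup>+xs. ennreal c * (adv_gain xs + (\<integral>\<^sup>+x. ennreal (\<Phi> (xs @ [x])) \<partial>measure_pmf (\<alpha> xs)))
          \<partial>measure_pmf (history_pmf \<alpha> T))"
    unfolding nn_integral_history_pmf_Suc by (simp add: nn_integral_cmult nn_integral_add)
  also have "\<dots> \<le> (\<integral>\<^sup>+xs. ennreal c * ennreal (\<Phi> xs) + (\<integral>\<^sup>+x. last_gain (xs @ [x]) \<partial>measure_pmf (\<alpha> xs))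
          \<partial>measure_pmf (history_pmf \<alpha> T))"
    by (intro nn_integral_mono_AE) (auto simp: AE_measure_pmf_iff intro: amortized_step)
  also have "\<dots> = ennreal c * ?u T + ?b T"
    unfolding nn_integral_history_pmf_Suc by (simp add: nn_integral_cmult nn_integral_add)
  finally have step: "ennreal c * (?a T + ?u (Suc T)) \<le> ennreal c * ?u T + ?b T" .
  have "ennreal c * ((\<Sum>t<Suc T. ?a t) + ?u (Suc T))
      = ennreal c * (\<Sum>t<T. ?a t) + ennreal c * (?a T + ?u (Suc T))"
    unfolding sum.lessThan_Suc distrib_left by (simp only: ac_simps)
  also have "\<dots> \<le> ennreal c * (\<Sum>t<T. ?a t) + (ennreal c * ?u T + ?b T)"
    using step by (rule add_left_mono)
  also have "\<dots> = ennreal c * ((\<Sum>t<T. ?a t) + ?u T) + ?b T"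
    unfolding distrib_left by (simp only: ac_simps)
  also have "\<dots> \<le> (\<Sum>t<T. ?b t) + ?b T"
    using Suc.IH by (rule add_right_mono)
  finally show ?case by (simp only: sum.lessThan_Suc)
qed

text \<open>Monotone convergence exchanges sum and expectation, and each summand depends only on a
  history, whose law is \<open>history_pmf\<close>.\<close>

lemma expected_adv_gain:
  "(\<integral>\<^sup>+\<omega>. gain (run_inst inject \<omega>) (adv_schedule adv \<omega>) \<partial>run_space (mix_r tie) inject)
     = (\<Sum>t. \<integral>\<^sup>+xs. adv_gain xs \<partial>measure_pmf (history_pmf \<alpha> t))"
proof -
  have "gain (run_inst inject \<omega>) (adv_schedule adv \<omega>) = (\<Sum>t. adv_gain (run_history \<omega> t))"
    if "good \<omega>" for \<omega>
    unfolding gain_eq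
  proof (rule suminf_cong)
    fix t
    \<comment> \<open>Weights in the full and in the revealed instance agree here, because ADV only
      sends packets released by time \<open>t\<close>.\<close>
    show "ennreal (opt_weight (weight (run_inst inject \<omega>)) (adv_schedule adv \<omega> t)) = adv_gain (run_history \<omega> t)"
      using pending_nth(2)[OF adv_pending[OF that, of t]]
      by (cases "adv (run_history \<omega> t)")
         (auto simp: adv_gain_def adv_schedule_def weight_def revealed_run_history)
  qed
  then have "(\<integral>\<^sup>+\<omega>. gain (run_inst inject \<omega>) (adv_schedule adv \<omega>) \<partial>run_space (mix_r tie) inject)
      = (\<integral>\<^sup>+\<omega>. (\<Sum>t. adv_gain (run_history \<omega> t)) \<partial>run_space (mix_r tie) inject)"
    using AE_good by (intro nn_integral_cong_AE) (auto elim: eventually_mono)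
  also have "\<dots> = (\<Sum>t. \<integral>\<^sup>+\<omega>. adv_gain (run_history \<omega> t) \<partial>run_space (mix_r tie) inject)"
    unfolding run_space_def
    by (intro nn_integral_suminf measurable_compose[OF measurable_run_history]) auto
  finally show ?thesis
    unfolding run_space_def nn_integral_run_history[where f = adv_gain and \<alpha> = \<alpha>] .
qed

lemma expected_alg_gain:
  "(\<integral>\<^sup>+\<omega>. gain (run_inst inject \<omega>) (alg_schedule \<omega>) \<partial>run_space (mix_r tie) inject)
     = (\<Sum>t. \<integral>\<^sup>+xs. last_gain xs \<partial>measure_pmf (history_pmf \<alpha> (Suc t)))"
proof -
  have "gain (run_inst inject \<omega>) (alg_schedule \<omega>) = (\<Sum>t. last_gain (run_history \<omega> (Suc t)))"
    if "good \<omega>" for \<omega>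
    unfolding gain_eq
  proof (rule suminf_cong)
    fix t
    have "\<omega> (run_history \<omega> t) \<in> set_pmf (\<alpha> (run_history \<omega> t))"
      using that by (simp add: good_def)
    then show "ennreal (opt_weight (weight (run_inst inject \<omega>)) (alg_schedule \<omega> t)) = last_gain (run_history \<omega> (Suc t))"
      using pending_nth(2)[OF alg_pending[OF that, of _ t]]
      by (cases "\<omega> (run_history \<omega> t)")
         (auto simp: last_gain_def alg_schedule_def weight_def revealed_run_history)
  qed
  then have "(\<integral>\<^sup>+\<omega>. gain (run_inst inject \<omega>) (alg_schedule \<omega>) \<partial>run_space (mix_r tie) inject)
      = (\<integral>\<^sup>+\<omega>. (\<Sum>t. last_gain (run_history \<omega> (Suc t))) \<partial>run_space (mix_r tie) inject)"
    using AE_good by (intro nn_integral_cong_AE) (auto elim: eventually_mono simp del: run_history.simps)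
  also have "\<dots> = (\<Sum>t. \<integral>\<^sup>+\<omega>. last_gain (run_history \<omega> (Suc t)) \<partial>run_space (mix_r tie) inject)"
    unfolding run_space_def
    by (intro nn_integral_suminf measurable_compose[OF measurable_run_history]) auto
  finally show ?thesis
    unfolding run_space_def nn_integral_run_history[where f = last_gain and \<alpha> = \<alpha>] .
qed

lemma competitive:
  "ennreal c * (\<integral>\<^sup>+\<omega>. gain (run_inst inject \<omega>) (adv_schedule adv \<omega>) \<partial>run_space (mix_r tie) inject)
     \<le> (\<integral>\<^sup>+\<omega>. gain (run_inst inject \<omega>) (alg_schedule \<omega>) \<partial>run_space (mix_r tie) inject)"
proof -
  let ?a = "\<lambda>t. \<integral>\<^sup>+xs. adv_gain xs \<partial>measure_pmf (history_pmf \<alpha> t)"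
  let ?b = "\<lambda>t. \<integral>\<^sup>+xs. last_gain xs \<partial>measure_pmf (history_pmf \<alpha> (Suc t))"
  have "(\<Sum>t<T. ennreal c * ?a t) \<le> (\<Sum>t. ?b t)" for T
  proof -
    have "(\<Sum>t<T. ennreal c * ?a t) = ennreal c * (\<Sum>t<T. ?a t)"
      by (rule sum_distrib_left[symmetric])
    also have "\<dots> \<le> ennreal c * ((\<Sum>t<T. ?a t) + (\<integral>\<^sup>+xs. ennreal (\<Phi> xs) \<partial>measure_pmf (history_pmf \<alpha> T)))"
      by (intro mult_left_mono) auto
    also have "\<dots> \<le> (\<Sum>t<T. ?b t)" by (rule amortized_sum)
    also have "\<dots> \<le> (\<Sum>t. ?b t)" by (rule sum_le_suminf) (auto intro: summableI)
    finally show ?thesis .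
  qed
  then have "(\<Sum>t. ennreal c * ?a t) \<le> (\<Sum>t. ?b t)"
    by (intro suminf_le_const summableI)
  then show ?thesis
    unfolding expected_adv_gain expected_alg_gain ennreal_suminf_cmult .
qed

end

lemma mix_r_competitive:
  assumes "1 \<le> s" "tie_breaking tie"
    and C: "\<And>inject \<omega> t. C (run_inst inject \<omega>) \<Longrightarrow> few_nondominated s (revealed inject (run_history \<omega> t))"
  shows "competitive_adaptive (1 / (1 - (1 - 1 / real s) ^ s)) C (mix_r tie)"
  unfolding competitive_adaptive_def
proof (intro allI impI)
  fix inject adv
  assume AE: "AE \<omega> in run_space (mix_r tie) inject. valid_inst (run_inst inject \<omega>) \<and>
    C (run_inst inject \<omega>) \<and> feasible (run_inst inject \<omega>) (adv_schedule adv \<omega>)"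
  interpret adaptive_run s tie inject adv
  proof
    show "AE \<omega> in run_space (mix_r tie) inject.
      valid_inst (run_inst inject \<omega>) \<and> feasible (run_inst inject \<omega>) (adv_schedule adv \<omega>) \<and>
      (\<forall>t. few_nondominated s (revealed inject (run_history \<omega> t)))"
      using AE by eventually_elim (auto intro: C)
  qed fact+
  show "(\<integral>\<^sup>+\<omega>. gain (run_inst inject \<omega>) (alg_schedule \<omega>) \<partial>run_space (mix_r tie) inject)
      \<ge> ennreal (1 / (1 / (1 - (1 - 1 / real s) ^ s))) *
        (\<integral>\<^sup>+\<omega>. gain (run_inst inject \<omega>) (adv_schedule adv \<omega>) \<partial>run_space (mix_r tie) inject)"
    using competitive by simp
qed

theorem mainTheorem3:
  fixes s :: nat and tie :: tie_rule
  assumes "s \<ge> 1" and "tie_breaking tie"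
  shows "competitive_adaptive (1 / (1 - (1 - 1 / real s) ^ s)) (bounded_inst s) (mix_r tie)
       \<and> competitive_adaptive (1 / (1 - (1 - 1 / real s) ^ s)) (few_weights s) (mix_r tie)
       \<and> competitive_adaptive (4 / 3) (bounded_inst 2) (mix_r tie)"
proof (intro conjI)
  \<comment> \<open>Stated for every \<open>s\<close> because it is used for the given value and for
    2, where the ratio is \<open>1 / (1 - 1/4) = 4/3\<close>.\<close>
  have bounded: "competitive_adaptive (1 / (1 - (1 - 1 / real s) ^ s)) (bounded_inst s) (mix_r tie)"
    if "1 \<le> s" for s
    by (rule mix_r_competitive[OF that assms(2)])
       (intro bounded_inst_few_nondominated bounded_inst_revealed)
  then show "competitive_adaptive (1 / (1 - (1 - 1 / real s) ^ s)) (bounded_inst s) (mix_r tie)"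
    using assms(1) .
  show "competitive_adaptive (1 / (1 - (1 - 1 / real s) ^ s)) (few_weights s) (mix_r tie)"
    by (rule mix_r_competitive[OF assms])
       (intro few_weights_few_nondominated few_weights_revealed)
  show "competitive_adaptive (4 / 3) (bounded_inst 2) (mix_r tie)"
    using bounded[of 2] by (simp add: power2_eq_square)
qed

end
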